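(* For $p>1$ and $\alpha>0$ let $\mu(\alpha)$ be the bifurcation parameter for which the problem $-v''=\mu(v^p+v\sin^2 v)$ in $(0,1)$, $v>0$ in $(0,1)$, $v(0)=v(1)=0$ has a solution with $\Vert v\Vert_\infty=\alpha$. With the constants defined in the context: (i) Let $1<p<2$. Then as $\alpha\to\infty$, $$\mu(\alpha)=2(p+1)\alpha^{1-p}\Big\{C_{0,p}+\big(C_1+\tfrac12C_{11}\big)\alpha^{1-p}+(C_2+C_3)\alpha^{2(1-p)}+o(\alpha^{2(1-p)})\Big\}^2.$$ (ii) Let $p=2$. Then as $\alpha\to\infty$, $$\mu(\alpha)=6\alpha^{-1}\Big\{C_{0,p}+\big(C_1+\tfrac12C_{11}\big)\alpha^{-1}+\big(\tfrac12C_{12}+\tfrac12C_{21}+C_2+C_3\big)\alpha^{-2}+o(\alpha^{2(1-p)})\Big\}^2$$ (with $p=2$ throughout, so that $o(\alpha^{2(1-p)})=o(\alpha^{-2})$).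
   Context: Consider, for $p>1$ and a parameter $\mu>0$, the problem $-v''(x)=\mu(v(x)^p+v(x)\sin^2v(x))$ for $x\in I:=(0,1)$, $v(x)>0$ for $x\in I$, $v(0)=v(1)=0$. It is known that for every $\alpha>0$ there is a unique pair $(\mu,v_\alpha)\in\mathbb{R}_+\times C^2(\bar I)$ solving it with $\Vert v_\alpha\Vert_\infty=\alpha$; one writes $\mu=\mu(\alpha)$. Constants (some depend on $\alpha$): $C_{0,p}:=\int_0^1\frac{1}{\sqrt{1-s^{p+1}}}ds$, $C_1:=-\frac{p+1}{8}\int_0^1\frac{1-s^2}{(1-s^{p+1})^{3/2}}ds$, $C_{11}:=\frac{2}{p+1}\int_0^{\pi/2}\cos(2\alpha\sin^{2/(p+1)}\theta)\sin^{(3-p)/(p+1)}\theta\,d\theta$, $C_{12}:=\frac{p-1}{2(p+1)}\int_0^{\pi/2}(\sin2\alpha-\sin(2\alpha\sin^{2/(p+1)}\theta))\sin^{(1-p)/(p+1)}\theta\,d\theta+\frac{p+1}{4}\int_0^1\frac{1-s}{(1-s^{p+1})^{3/2}}\sin(2\alpha s)ds$, $C_{21}:=-\frac{1}{p+1}\int_0^{\pi/2}\sin(2\alpha\sin^{2/(p+1)}\theta)\sin^{(3-p)/(p+1)}\theta\,d\theta$, $C_2:=\frac{3(p+1)^2}{128}\int_0^1\frac{(1-s^2)^2}{(1-s^{p+1})^{5/2}}ds$, $C_3:=-\frac{3}{32}(p+1)^2\int_0^1\left(\int_0^s\frac{1-y^2}{(1-y^{p+1})^{5/2}}dy\right)\cos(2\alpha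 s)ds$. *)

theory Defs
  imports "HOL-Analysis.Analysis" "HOL-Library.Landau_Symbols"
begin

text \<open>
  Twice continuously differentiable on the closed interval \<open>[0,1]\<close>, with first and second
  derivatives \<open>v1\<close> and \<open>v2\<close>; the derivatives at the end points are one-sided.
\<close>

definition C2_unit_interval :: "(real \<Rightarrow> real) \<Rightarrow> (real \<Rightarrow> real) \<Rightarrow> (real \<Rightarrow> real) \<Rightarrow> bool" where
  "C2_unit_interval v v1 v2 \<longleftrightarrow>
     (\<forall>x\<in>{0..1}. (v has_real_derivative v1 x) (at x within {0..1})) \<and>
     (\<forall>x\<in>{0..1}. (v1 has_real_derivative v2 x) (at x within {0..1})) \<and>
     continuous_on {0..1} v2"

definition is_solution :: "real \<Rightarrow> real \<Rightarrow> (real \<Rightarrow> real) \<Rightarrow> bool" where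
  "is_solution p \<mu> v \<longleftrightarrow>
     (\<exists>v1 v2. C2_unit_interval v v1 v2 \<and>
        (\<forall>x\<in>{0<..<1}. - v2 x = \<mu> * (v x powr p + v x * (sin (v x))\<^sup>2))) \<and>
     (\<forall>x\<in>{0<..<1}. v x > 0) \<and> v 0 = 0 \<and> v 1 = 0"

definition sup_norm :: "(real \<Rightarrow> real) \<Rightarrow> real" where
  "sup_norm v = (SUP x\<in>{0..1}. \<bar>v x\<bar>)"

definition bifurcation_parameter :: "real \<Rightarrow> real \<Rightarrow> real \<Rightarrow> bool" where
  "bifurcation_parameter p \<alpha> \<mu> \<longleftrightarrow>
     \<mu> > 0 \<and> (\<exists>v. is_solution p \<mu> v \<and> sup_norm v = \<alpha>)"

text \<open>
  For \<open>p > 1\<close> all integrands below are absolutely integrable, so the gauge integral agrees with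
  the Lebesgue integral. Where an integrand is singular at an end point (including the inner
  integral of \<open>C3\<close>, which diverges for \<open>s = 1\<close>), totalised division, \<open>0 powr a = 0\<close> and
  the default value of \<open>integral\<close> affect a single point only.
\<close>

definition C0 :: "real \<Rightarrow> real" where
  "C0 p = integral {0..1} (\<lambda>s. 1 / sqrt (1 - s powr (p + 1)))"

definition C1 :: "real \<Rightarrow> real" where
  "C1 p = - ((p + 1) / 8) *
     integral {0..1} (\<lambda>s. (1 - s\<^sup>2) / (1 - s powr (p + 1)) powr (3/2))"

definition C11 :: "real \<Rightarrow> real \<Rightarrow> real" where
  "C11 p \<alpha> = 2 / (p + 1) *
     integral {0..pi/2} (\<lambda>\<theta>. cos (2 * \<alpha> * sin \<theta> powr (2 / (p + 1)))
                               * sin \<theta> powr ((3 - p) / (p + 1)))"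

definition C12 :: "real \<Rightarrow> real \<Rightarrow> real" where
  "C12 p \<alpha> =
     (p - 1) / (2 * (p + 1)) *
       integral {0..pi/2} (\<lambda>\<theta>. (sin (2 * \<alpha>) - sin (2 * \<alpha> * sin \<theta> powr (2 / (p + 1))))
                                 * sin \<theta> powr ((1 - p) / (p + 1)))
     + (p + 1) / 4 *
       integral {0..1} (\<lambda>s. (1 - s) / (1 - s powr (p + 1)) powr (3/2) * sin (2 * \<alpha> * s))"

definition C21 :: "real \<Rightarrow> real \<Rightarrow> real" where
  "C21 p \<alpha> = - (1 / (p + 1)) *
     integral {0..pi/2} (\<lambda>\<theta>. sin (2 * \<alpha> * sin \<theta> powr (2 / (p + 1)))
                               * sin \<theta> powr ((3 - p) / (p + 1)))"

definition C2 :: "real \<Rightarrow> real" where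
  "C2 p = 3 * (p + 1)\<^sup>2 / 128 *
     integral {0..1} (\<lambda>s. (1 - s\<^sup>2)\<^sup>2 / (1 - s powr (p + 1)) powr (5/2))"

definition C3 :: "real \<Rightarrow> real \<Rightarrow> real" where
  "C3 p \<alpha> = - (3 / 32) * (p + 1)\<^sup>2 *
     integral {0..1} (\<lambda>s. integral {0..s} (\<lambda>y. (1 - y\<^sup>2) / (1 - y powr (p + 1)) powr (5/2))
                            * cos (2 * \<alpha> * s))"

end

theory Submission
  imports Defs
begin

text \<open>
Conservation of energy reduces the boundary value problem to an integral. If \<open>v\<close> solves the
problem with maximum \<open>\<alpha>\<close>, then the derivative of \<open>v\<close> is determined up to sign by \<open>v\<close> itself, and
measuring the time needed to climb from 0 to \<open>\<alpha>\<close> and to descend again gives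
\<open>\<mu> = 2 * (p + 1) * \<alpha> powr (1 - p) * J\<^sup>2\<close>, where \<open>J\<close> is the integral over \<open>[0, 1]\<close> of
\<open>1 / sqrt (A + (p + 1) * \<alpha> powr (1 - p) * B)\<close> with \<open>A = 1 - s powr (p + 1)\<close> (lemma
\<open>time_map_formula\<close>). The perturbation \<open>B\<close> comes from the term \<open>v * (sin v)\<^sup>2\<close>; it satisfies
\<open>0 \<le> B \<le> A\<close>, and it differs from \<open>(1 - s\<^sup>2) / 4\<close> by oscillating terms with negative powers of \<open>\<alpha>\<close>.

The theorem is the second-order Taylor expansion of \<open>J\<close> in \<open>\<epsilon> = \<alpha> powr (1 - p)\<close>
(\<open>time_map_expansion\<close>). The zeroth coefficient is \<open>C0\<close>. The coefficient of \<open>\<epsilon>\<^sup>2\<close> converges to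
\<open>C2\<close> by dominated convergence (\<open>second_order_tendsto\<close>). The coefficient of \<open>\<epsilon>\<close> is
proportional to the integral of \<open>B / A powr (3/2)\<close>, and here the oscillating terms matter: the
denominator is so singular at \<open>s = 1\<close> that a term with prefactor \<open>1 / \<alpha>\<close> can contribute in order
1. A substitution followed by an integration by parts (\<open>singular_integral_by_parts\<close>) makes these
contributions explicit, and the coefficient equals \<open>C1 + C11 / 2 + (C12 + C21) / (2 * \<alpha>)\<close> up to a
multiple of \<open>1 / \<alpha>\<^sup>2\<close> that stays bounded (\<open>first_order_expansion\<close>).

Finally \<open>C3\<close> is the integral of an integrable monotone function against \<open>cos (2 * \<alpha> * s)\<close>, so it
tends to 0 (\<open>C3_tendsto_0\<close>) and its product with \<open>\<epsilon>\<^sup>2\<close> is compatible with the stated error. The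
term with \<open>C12\<close> and \<open>C21\<close> has order \<open>\<alpha> powr (- p)\<close>, which equals \<open>\<epsilon>\<^sup>2\<close> for \<open>p = 2\<close> and is of
smaller order for \<open>p < 2\<close>; this is the difference between the two cases.
\<close>

section \<open>The potential gap and integrability near its zero\<close>

text \<open>
Let \<open>F\<close> be the primitive of \<open>v powr p + v * (sin v)\<^sup>2\<close> with \<open>F 0 = 0\<close>. The energy identity
of the equation involves \<open>F \<alpha> - F (\<alpha> * s)\<close>, and dividing this difference by
\<open>\<alpha> powr (p + 1) / (p + 1)\<close> gives \<open>gap p \<alpha> s\<close>. Its part \<open>lead\<close> comes from the
power \<open>v powr p\<close>. The other part \<open>pert\<close> is the integral of \<open>v * (sin v)\<^sup>2\<close> from \<open>\<alpha> * s\<close> to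
\<open>\<alpha>\<close>, divided by \<open>\<alpha>\<^sup>2\<close>.
\<close>

definition lead :: "real \<Rightarrow> real \<Rightarrow> real" where
  "lead p s = 1 - s powr (p + 1)"

definition pert :: "real \<Rightarrow> real \<Rightarrow> real" where
  "pert \<alpha> s = (1 - s\<^sup>2) / 4 - (sin (2 * \<alpha>) - s * sin (2 * \<alpha> * s)) / (4 * \<alpha>)
     - (cos (2 * \<alpha>) - cos (2 * \<alpha> * s)) / (8 * \<alpha>\<^sup>2)"

definition gap :: "real \<Rightarrow> real \<Rightarrow> real \<Rightarrow> real" where
  "gap p \<alpha> s = lead p s + (p + 1) * \<alpha> powr (1 - p) * pert \<alpha> s"

text \<open>
In the integrands below this bounds \<open>1 / sqrt (lead p s)\<close> by \<open>1 / sqrt (1 - s)\<close>, and a numerator of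
size \<open>1 - s\<close> compensates one power of \<open>lead\<close> in the denominator.
\<close>

lemma lead_ge:
  assumes "p > 1" "0 \<le> s" "s \<le> 1"
  shows "1 - s \<le> lead p s"
proof -
  have "s powr (p + 1) \<le> s powr 1"
    using assms by (intro powr_mono') auto
  then show ?thesis using assms by (simp add: lead_def)
qed

lemma lead_1 [simp]: "lead p 1 = 0"
  by (simp add: lead_def)

lemma lead_pos: "p > 1 \<Longrightarrow> 0 \<le> s \<Longrightarrow> s < 1 \<Longrightarrow> 0 < lead p s"
  using lead_ge[of p s] by auto

lemma lead_nonneg: "p > 1 \<Longrightarrow> 0 \<le> s \<Longrightarrow> s \<le> 1 \<Longrightarrow> 0 \<le> lead p s"
  using lead_ge[of p s] by auto

lemma measurable_lead [measurable]: "lead p \<in> borel_measurable borel"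
  unfolding lead_def by measurable

lemma measurable_pert [measurable]: "pert \<alpha> \<in> borel_measurable borel"
  unfolding pert_def by measurable

lemma measurable_gap [measurable]: "gap p \<alpha> \<in> borel_measurable borel"
  unfolding gap_def by measurable

lemma powr_3_2: "x \<ge> 0 \<Longrightarrow> x powr (3/2) = x * sqrt (x::real)"
  using powr_add[of x 1 "1/2"] by (simp add: powr_half_sqrt)

lemma powr_5_2: "x \<ge> 0 \<Longrightarrow> x powr (5/2) = x\<^sup>2 * sqrt (x::real)"
  using powr_add[of x 2 "1/2"] by (cases "x = 0") (simp_all add: powr_half_sqrt)

lemma has_integral_inverse_sqrt:
  assumes "b \<le> 1"
  shows "((\<lambda>s. c / sqrt (1 - s)) has_integral 2 * c * sqrt (1 - b)) {b..1::real}"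
proof -
  have "((\<lambda>s. c / sqrt (1 - s)) has_integral (- 2 * c * sqrt (1 - 1)) - (- 2 * c * sqrt (1 - b))) {b..1}"
    by (rule fundamental_theorem_of_calculus_interior[OF assms])
       (auto intro!: continuous_intros derivative_eq_intros
         simp: has_real_derivative_iff_has_vector_derivative[symmetric] field_simps)
  then show ?thesis by simp
qed

lemma inverse_sqrt_lead_le:
  assumes "p > 1" "0 \<le> s" "s \<le> 1"
  shows "1 / sqrt (lead p s) \<le> 1 / sqrt (1 - s)"
  using assms lead_ge[of p s] by (cases "s = 1") (auto intro!: divide_left_mono mult_pos_pos lead_pos)

lemma integrable_borel_dominated:
  fixes f g :: "real \<Rightarrow> real"
  assumes "f \<in> borel_measurable borel" "g integrable_on {a..b}"
    and "\<And>s. s \<in> {a..b} \<Longrightarrow> \<bar>f s\<bar> \<le> g s"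
  shows "f integrable_on {a..b}"
  by (rule measurable_bounded_by_integrable_imp_integrable[OF _ assms(2)])
     (use assms in \<open>auto intro!: measurable_restrict_space1 measurable_completion\<close>)

lemma integrable_inverse_sqrt_lead:
  assumes "p > 1"
  shows "(\<lambda>s. 1 / sqrt (lead p s)) integrable_on {0..1}"
proof (rule integrable_borel_dominated)
  show "(\<lambda>s. 1 / sqrt (1 - s)) integrable_on {0..1::real}"
    using has_integral_inverse_sqrt[of 0 1] by auto
qed (use assms inverse_sqrt_lead_le lead_nonneg in auto)

lemma integrable_dominated_by_lead:
  assumes "p > 1" "f \<in> borel_measurable borel"
    and "\<And>s. 0 \<le> s \<Longrightarrow> s < 1 \<Longrightarrow> \<bar>f s\<bar> \<le> M / sqrt (lead p s)" "f 1 = 0"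
  shows "f integrable_on {0..1}"
proof (rule integrable_borel_dominated[OF assms(2)])
  show "(\<lambda>s. M * (1 / sqrt (lead p s))) integrable_on {0..1}"
    using integrable_cmul[OF integrable_inverse_sqrt_lead[OF assms(1)], of M] by simp
  show "\<bar>f s\<bar> \<le> M * (1 / sqrt (lead p s))" if "s \<in> {0..1}" for s
    using assms(3)[of s] assms(4) that by (cases "s = 1") auto
qed

lemma integrable_over_lead_3_2:
  assumes p: "p > 1" and [measurable]: "h \<in> borel_measurable borel"
    and h: "\<And>s. 0 \<le> s \<Longrightarrow> s \<le> 1 \<Longrightarrow> \<bar>h s\<bar> \<le> M * (1 - s)"
  shows "(\<lambda>s. h s / lead p s powr (3/2)) integrable_on {0..1}"
proof (rule integrable_dominated_by_lead[OF p])
  show "\<bar>h s / lead p s powr (3/2)\<bar> \<le> M / sqrt (lead p s)" if s: "0 \<le> s" "s < 1" for s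
  proof -
    have A: "lead p s > 0" using lead_pos[OF p] s by auto
    have "0 \<le> M" using h[of 0] by auto
    then have "\<bar>h s\<bar> \<le> M * lead p s"
      using h[of s] s lead_ge[OF p, of s] by (auto intro: order_trans mult_left_mono)
    then show ?thesis using A by (simp add: powr_3_2 abs_mult field_simps)
  qed
qed auto

text \<open>
The explicit formula for \<open>pert\<close> is what the expansion needs, whereas its sign and size are
best seen from the derivative, in which the trigonometric terms combine to a square.
\<close>

lemma pert_deriv:
  assumes "\<alpha> > 0"
  shows "(pert \<alpha> has_real_derivative - s * (sin (\<alpha> * s))\<^sup>2) (at s)"
proof -
  have c: "cos (\<alpha> * (s * 2)) = 1 - 2 * (sin (\<alpha> * s))\<^sup>2"
    using cos_double_sin[of "\<alpha> * s"] by (simp add: mult_ac)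
  show ?thesis
    unfolding pert_def using assms
    by (auto intro!: derivative_eq_intros simp: field_simps power2_eq_square c)
qed

lemma pert_bounds:
  assumes "\<alpha> > 0" "0 \<le> s" "s \<le> 1"
  shows "0 \<le> pert \<alpha> s" "pert \<alpha> s \<le> 1 - s"
proof -
  have nonpos: "- x * (sin (\<alpha> * x))\<^sup>2 \<le> 0" if "s \<le> x" for x
    using that assms(2) by simp
  have "pert \<alpha> s \<ge> pert \<alpha> 1"
    by (rule DERIV_nonpos_imp_nonincreasing[OF assms(3)])
       (use pert_deriv[OF assms(1)] assms(2) in \<open>blast intro: nonpos\<close>)
  then show "0 \<le> pert \<alpha> s" by (simp add: pert_def)
  have "1 - 1 - pert \<alpha> 1 \<le> 1 - s - pert \<alpha> s"
  proof (rule DERIV_nonpos_imp_nonincreasing[OF assms(3)])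
    fix x assume x: "s \<le> x" "x \<le> 1"
    have "x * (sin (\<alpha> * x))\<^sup>2 \<le> 1 * 1"
      using x assms by (intro mult_mono) (auto simp: abs_square_le_1)
    then show "\<exists>y. ((\<lambda>s. 1 - s - pert \<alpha> s) has_real_derivative y) (at x) \<and> y \<le> 0"
      by (intro exI[of _ "- 1 + x * (sin (\<alpha> * x))\<^sup>2"])
         (auto intro!: derivative_eq_intros pert_deriv assms)
  qed
  then show "pert \<alpha> s \<le> 1 - s" by (simp add: pert_def)
qed

lemma pert_le_lead:
  assumes "p > 1" "\<alpha> > 0" "0 \<le> s" "s \<le> 1"
  shows "pert \<alpha> s \<le> lead p s"
  using pert_bounds[OF assms(2-)] lead_ge[OF assms(1,3,4)] by auto

lemma gap_ge_lead:
  assumes "p > 1" "\<alpha> > 0" "0 \<le> s" "s \<le> 1"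
  shows "lead p s \<le> gap p \<alpha> s"
  using pert_bounds[OF assms(2-)] assms(1,2) by (auto simp: gap_def)

lemma gap_pos: "p > 1 \<Longrightarrow> \<alpha> > 0 \<Longrightarrow> 0 \<le> s \<Longrightarrow> s < 1 \<Longrightarrow> 0 < gap p \<alpha> s"
  using gap_ge_lead[of p \<alpha> s] lead_pos[of p s] by auto

lemma gap_1 [simp]: "gap p \<alpha> 1 = 0"
  by (simp add: gap_def pert_def)

text \<open>
The time, up to scaling, that a solution of amplitude \<open>\<alpha>\<close> takes to climb from 0 to its maximum.
\<close>

definition time_map :: "real \<Rightarrow> real \<Rightarrow> real" where
  "time_map p \<alpha> = integral {0..1} (\<lambda>s. 1 / sqrt (gap p \<alpha> s))"

lemma integrable_inverse_sqrt_gap: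
  assumes "p > 1" "\<alpha> > 0"
  shows "(\<lambda>s. 1 / sqrt (gap p \<alpha> s)) integrable_on {0..1}"
proof (rule integrable_dominated_by_lead[OF assms(1), where M = 1])
  show "\<bar>1 / sqrt (gap p \<alpha> s)\<bar> \<le> 1 / sqrt (lead p s)" if "0 \<le> s" "s < 1" for s
    using gap_ge_lead[OF assms, of s] lead_pos[of p s] gap_pos[of p \<alpha> s] assms that
    by (auto intro!: divide_left_mono)
qed auto

lemma gap_deriv:
  assumes "\<alpha> > 0" "s > 0"
  shows "(gap p \<alpha> has_real_derivative
    - (p + 1) * (s powr p + \<alpha> powr (1 - p) * s * (sin (\<alpha> * s))\<^sup>2)) (at s)"
proof -
  have "((\<lambda>s. s powr (p + 1)) has_real_derivative (p + 1) * s powr p) (at s)"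
    using has_real_derivative_powr[OF assms(2), of "p + 1"] by simp
  from DERIV_add[OF DERIV_diff[OF DERIV_const this]
      DERIV_cmult[OF pert_deriv[OF assms(1)], of "(p + 1) * \<alpha> powr (1 - p)"], of 1]
  show ?thesis unfolding gap_def lead_def
    by (rule DERIV_cong) (simp add: algebra_simps)
qed

lemma continuous_lead: "p > 1 \<Longrightarrow> continuous_on {0..1} (lead p)"
  unfolding lead_def
  by (intro continuous_on_diff continuous_on_const continuous_on_powr' continuous_on_id) auto

lemma continuous_pert: "continuous_on S (pert \<alpha>)"
  unfolding pert_def divide_inverse by (intro continuous_intros)

lemma continuous_gap: "p > 1 \<Longrightarrow> continuous_on {0..1} (gap p \<alpha>)"
  unfolding gap_def by (intro continuous_on_add continuous_on_mult continuous_on_const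
      continuous_lead continuous_pert)

section \<open>The time map of the boundary value problem\<close>

lemma has_real_derivative_integral:
  fixes f :: "real \<Rightarrow> real"
  assumes "f integrable_on {a..b}" "a < x" "x < b" "isCont f x"
  shows "((\<lambda>u. integral {a..u} f) has_real_derivative f x) (at x)"
proof -
  have "((\<lambda>u. integral {a..u} f) has_vector_derivative f x) (at x within ({a..b} - {}))"
    using assms by (intro integral_has_vector_derivative_continuous_at)
      (auto intro: continuous_at_imp_continuous_at_within)
  then show ?thesis
    using assms by (simp add: has_real_derivative_iff_has_vector_derivative at_within_Icc_at)
qed

text \<open>
A solution is concave, so it increases up to a single maximum point \<open>x0\<close> and then decreases.
The energy \<open>(v1 x)\<^sup>2 / 2 + \<mu> * F (v x)\<close> is conserved, which expresses \<open>\<bar>v1 x\<bar>\<close> through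
\<open>v x\<close>. Hence the primitive \<open>\<Psi>\<close> of \<open>1 / sqrt (gap p \<alpha> s)\<close>, evaluated along \<open>v / \<alpha>\<close>, has
constant slope \<open>c\<close> on the left of \<open>x0\<close> and \<open>- c\<close> on the right. On each side it runs
between \<open>0\<close> and the value of \<open>time_map\<close>, and since the interval has length 1 this gives
\<open>c = 2 * time_map p \<alpha>\<close>.
\<close>

lemma time_map_formula:
  assumes p: "p > 1" and \<alpha>: "\<alpha> > 0" and bif: "bifurcation_parameter p \<alpha> \<mu>"
  shows "\<mu> = 2 * (p + 1) * \<alpha> powr (1 - p) * (time_map p \<alpha>)\<^sup>2"
proof -
  from bif obtain v v1 v2 where \<mu>: "\<mu> > 0" and sup: "sup_norm v = \<alpha>"
    and C2: "C2_unit_interval v v1 v2"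
    and ode: "\<And>x. x \<in> {0<..<1} \<Longrightarrow> - v2 x = \<mu> * (v x powr p + v x * (sin (v x))\<^sup>2)"
    and pos: "\<And>x. x \<in> {0<..<1} \<Longrightarrow> v x > 0" and v0: "v 0 = 0" and v1: "v 1 = 0"
    unfolding bifurcation_parameter_def is_solution_def by blast
  have dv: "(v has_real_derivative v1 x) (at x)" and dv1: "(v1 has_real_derivative v2 x) (at x)"
    if "0 < x" "x < 1" for x
    using C2 that unfolding C2_unit_interval_def by (metis atLeastAtMost_iff at_within_Icc_at less_imp_le)+
  have cont: "continuous_on {0..1} v" "continuous_on {0..1} v1"
    using C2 unfolding C2_unit_interval_def
    by (auto simp: continuous_on_eq_continuous_within intro!: DERIV_continuous)
  have nonneg: "0 \<le> v x" if "x \<in> {0..1}" for x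
    using pos[of x] v0 v1 that by (cases "x = 0 \<or> x = 1") auto
  have dec: "v1 y < v1 x" if "0 \<le> x" "x < y" "y \<le> 1" for x y
  proof (rule DERIV_neg_imp_decreasing_open[OF \<open>x < y\<close>])
    fix z assume z: "x < z" "z < y"
    have "0 < \<mu> * (v z powr p + v z * (sin (v z))\<^sup>2)"
      using z that pos[of z] \<mu> by (intro mult_pos_pos add_pos_nonneg) auto
    then have "v2 z < 0" using ode[of z] z that by auto
    then show "\<exists>w. (v1 has_real_derivative w) (at z) \<and> w < 0"
      using dv1[of z] z that by auto
  qed (use cont(2) that in \<open>auto intro: continuous_on_subset\<close>)

  obtain x0 where x0: "x0 \<in> {0..1}" and max: "\<And>x. x \<in> {0..1} \<Longrightarrow> v x \<le> v x0"
    using continuous_attains_sup[of "{0..1::real}" v] cont(1) by auto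
  have "(SUP x\<in>{0..1}. \<bar>v x\<bar>) = v x0"
    by (rule cSup_eq_maximum) (use nonneg x0 max in \<open>auto intro!: rev_image_eqI[of x0]\<close>)
  then have vx0: "v x0 = \<alpha>" using sup by (simp add: sup_norm_def)
  have x0': "0 < x0" "x0 < 1"
    using x0 vx0 v0 v1 \<alpha> by (auto simp: less_le)
  have v1x0: "v1 x0 = 0"
    by (rule DERIV_local_max[OF dv[OF x0'], of "min x0 (1 - x0)"]) (use x0' in \<open>auto intro!: max\<close>)

  \<comment> \<open>\<open>E\<close> is the energy measured from its value at \<open>x0\<close>, so it vanishes identically.\<close>
  define K where "K = \<mu> * \<alpha> powr (p + 1) / (p + 1)"
  have K: "K > 0" using \<mu> \<alpha> p by (simp add: K_def)
  define E where "E x = (v1 x)\<^sup>2 / 2 - K * gap p \<alpha> (v x / \<alpha>)" for x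
  have range: "v x / \<alpha> \<in> {0..1}" if "x \<in> {0..1}" for x
    using max[OF that] nonneg[OF that] \<alpha> vx0 by auto
  have contE: "continuous_on {0..1} E"
    unfolding E_def using \<alpha> range
    by (intro continuous_intros cont continuous_on_compose2[OF continuous_gap[OF p, of \<alpha>], of _ "\<lambda>x. v x / \<alpha>"]) auto
  have derE: "(E has_real_derivative 0) (at x)" if x: "0 < x" "x < 1" for x
  proof -
    have vx: "v x > 0" using pos x by auto
    have "((\<lambda>x. gap p \<alpha> (v x / \<alpha>)) has_real_derivative
       - (p + 1) * ((v x / \<alpha>) powr p + \<alpha> powr (1 - p) * (v x / \<alpha>) * (sin (\<alpha> * (v x / \<alpha>)))\<^sup>2)
         * (v1 x / \<alpha>)) (at x)"
      using vx \<alpha> by (intro DERIV_chain2[OF gap_deriv DERIV_cdivide[OF dv[OF x]]]) auto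
    then have dE: "(E has_real_derivative (2 * v1 x * v2 x) / 2 - K * 
       (- (p + 1) * ((v x / \<alpha>) powr p + \<alpha> powr (1 - p) * (v x / \<alpha>) * (sin (\<alpha> * (v x / \<alpha>)))\<^sup>2)
         * (v1 x / \<alpha>))) (at x)"
      unfolding E_def by (auto intro!: derivative_eq_intros dv1 x)
    have Q: "K * (- (p + 1) * ((v x / \<alpha>) powr p
         + \<alpha> powr (1 - p) * (v x / \<alpha>) * (sin (\<alpha> * (v x / \<alpha>)))\<^sup>2) * (v1 x / \<alpha>))
       = - v1 x * (\<mu> * (v x powr p + v x * (sin (v x))\<^sup>2))"
    proof -
      define P where "P = \<alpha> powr p"
      have P: "P > 0" using \<alpha> by (simp add: P_def)
      have e: "\<alpha> powr (p + 1) = P * \<alpha>" "\<alpha> powr (1 - p) = \<alpha> / P"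
        "(v x / \<alpha>) powr p = v x powr p / P"
        using \<alpha> vx by (simp_all add: P_def powr_add powr_diff powr_divide)
      define q where "q = p + 1"
      have q: "q > 0" using p by (simp add: q_def)
      show ?thesis unfolding K_def e unfolding q_def[symmetric]
        using \<alpha> P q by (simp add: field_simps)
    qed
    have ode_x: "\<mu> * (v x powr p + v x * (sin (v x))\<^sup>2) = - v2 x" using ode[of x] x by simp
    show ?thesis using dE unfolding Q ode_x by simp
  qed
  have E0: "E x = E 0" if "x \<in> {0..1}" for x
    by (rule DERIV_isconst2[OF zero_less_one contE derE]) (use that in auto)
  have energy: "(v1 x)\<^sup>2 = 2 * K * gap p \<alpha> (v x / \<alpha>)" if "x \<in> {0..1}" for x
  proof -
    have "E x = E x0" using E0[OF that] E0[OF x0] by (rule trans[OF _ sym])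
    then show ?thesis using v1x0 vx0 \<alpha> by (simp add: E_def)
  qed
  \<comment> \<open>The maximum is attained only at \<open>x0\<close>: at any other such point the energy identity would
    make \<open>v1\<close> vanish a second time. This keeps \<open>v x / \<alpha>\<close> away from the singularity of the
    integrand at 1.\<close>
  have inner: "v x / \<alpha> < 1" if "0 < x" "x < 1" "x \<noteq> x0" for x
  proof (rule ccontr)
    assume "\<not> v x / \<alpha> < 1"
    then have "v x / \<alpha> = 1" using range[of x] that by auto
    then have "v1 x = 0" using energy[of x] that by simp
    then show False using dec[of x x0] dec[of x0 x] that x0' v1x0 by (cases x x0 rule: linorder_cases) auto
  qed

  define c where "c = sqrt (2 * K) / \<alpha>"
  let ?f = "\<lambda>s. 1 / sqrt (gap p \<alpha> s)"
  define \<Psi> where "\<Psi> y = integral {0..y} ?f" for y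
  have cont\<Psi>: "continuous_on {0..1} (\<lambda>x. \<Psi> (v x / \<alpha>))"
  proof (rule continuous_on_compose2[of "{0..1}" \<Psi>])
    show "continuous_on {0..1} \<Psi>"
      unfolding \<Psi>_def by (intro indefinite_integral_continuous_1 integrable_inverse_sqrt_gap p \<alpha>)
  qed (use range \<alpha> in \<open>auto intro!: continuous_intros cont\<close>)
  have der\<Psi>: "((\<lambda>x. \<Psi> (v x / \<alpha>)) has_real_derivative sgn (v1 x) * c) (at x)"
    if x: "0 < x" "x < 1" "x \<noteq> x0" for x
  proof -
    define y where "y = v x / \<alpha>"
    have y: "0 < y" "y < 1" using inner x pos[of x] \<alpha> by (auto simp: y_def)
    have g: "gap p \<alpha> y > 0" using gap_pos[OF p \<alpha>, of y] y by auto
    have "isCont ?f y"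
      using g DERIV_isCont[OF gap_deriv[OF \<alpha> y(1)]] by (intro continuous_intros) auto
    then have "(\<Psi> has_real_derivative 1 / sqrt (gap p \<alpha> y)) (at y)"
      unfolding \<Psi>_def
      using has_real_derivative_integral[OF integrable_inverse_sqrt_gap[OF p \<alpha>]] y by auto
    then have "((\<lambda>x. \<Psi> (v x / \<alpha>)) has_real_derivative 1 / sqrt (gap p \<alpha> y) * (v1 x / \<alpha>)) (at x)"
      unfolding y_def using x by (intro DERIV_chain2[OF _ DERIV_cdivide[OF dv]]) auto
    moreover have "1 / sqrt (gap p \<alpha> y) * (v1 x / \<alpha>) = sgn (v1 x) * c"
    proof -
      have "sqrt ((v1 x)\<^sup>2) = sqrt (2 * K) * sqrt (gap p \<alpha> y)"
        using energy[of x] x unfolding y_def real_sqrt_mult[symmetric] by simp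
      then have "\<bar>v1 x\<bar> = sqrt (2 * K) * sqrt (gap p \<alpha> y)" by simp
      then have "v1 x = sgn (v1 x) * (sqrt (2 * K) * sqrt (gap p \<alpha> y))"
        by (metis sgn_mult_abs)
      moreover define t where "t = sgn (v1 x)"
      ultimately have "v1 x = t * (sqrt (2 * K) * sqrt (gap p \<alpha> y))" by simp
      then show ?thesis using g unfolding c_def t_def[symmetric] by simp
    qed
    ultimately show ?thesis by simp
  qed
  have "\<Psi> (v x0 / \<alpha>) - c * x0 = \<Psi> (v 0 / \<alpha>) - c * 0"
  proof (rule DERIV_isconst_end[OF x0'(1)])
    show "continuous_on {0..x0} (\<lambda>x. \<Psi> (v x / \<alpha>) - c * x)"
      using x0' by (intro continuous_intros continuous_on_subset[OF cont\<Psi>]) auto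
    fix x assume x: "0 < x" "x < x0"
    then have "sgn (v1 x) = 1" using dec[of x x0] v1x0 x0' by auto
    then show "((\<lambda>x. \<Psi> (v x / \<alpha>) - c * x) has_real_derivative 0) (at x)"
      using der\<Psi>[of x] x x0' by (auto intro!: derivative_eq_intros)
  qed
  moreover have "\<Psi> (v 1 / \<alpha>) + c * 1 = \<Psi> (v x0 / \<alpha>) + c * x0"
  proof (rule DERIV_isconst_end[OF x0'(2)])
    show "continuous_on {x0..1} (\<lambda>x. \<Psi> (v x / \<alpha>) + c * x)"
      using x0' by (intro continuous_intros continuous_on_subset[OF cont\<Psi>]) auto
    fix x assume x: "x0 < x" "x < 1"
    then have "sgn (v1 x) = -1" using dec[of x0 x] v1x0 x0' by auto
    then show "((\<lambda>x. \<Psi> (v x / \<alpha>) + c * x) has_real_derivative 0) (at x)"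
      using der\<Psi>[of x] x x0' by (auto intro!: derivative_eq_intros)
  qed
  ultimately have "c = 2 * time_map p \<alpha>"
    using \<alpha> by (simp add: vx0 v0 v1 \<Psi>_def time_map_def)
  moreover have "c\<^sup>2 = 2 * K / \<alpha>\<^sup>2"
    using K by (simp add: c_def power_divide)
  ultimately have "2 * K / \<alpha>\<^sup>2 = 4 * (time_map p \<alpha>)\<^sup>2" by simp
  then have "(time_map p \<alpha>)\<^sup>2 = 2 * K / \<alpha>\<^sup>2 / 4" by simp
  moreover define q where "q = p + 1"
  ultimately have T: "(time_map p \<alpha>)\<^sup>2 = \<mu> * \<alpha> powr (p + 1) / q / (2 * \<alpha>\<^sup>2)"
    by (simp add: K_def)
  have "\<alpha> powr (p + 1) * \<alpha> powr (1 - p) = \<alpha>\<^sup>2"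
    using \<alpha> by (simp add: powr_add[symmetric])
  moreover have "2 * q * \<alpha> powr (1 - p) * (time_map p \<alpha>)\<^sup>2
      = \<mu> * (\<alpha> powr (p + 1) * \<alpha> powr (1 - p)) / \<alpha>\<^sup>2"
    unfolding T using p by (simp add: q_def del: distrib_left_numeral)
  ultimately show ?thesis using \<alpha> unfolding q_def by simp
qed

section \<open>Taylor expansion of the time map\<close>

text \<open>
The remainder of \<open>1 / sqrt (1 + x)\<close> after its linear Taylor polynomial, divided by \<open>x\<^sup>2\<close>.
Writing it in terms of \<open>t = sqrt (1 + x)\<close>, where \<open>x = (t - 1) * (t + 1)\<close>, cancels the factor
\<open>x\<^sup>2\<close>, so that the function is continuous at 0 with value \<open>3/8\<close>.
\<close>

definition taylor_coeff :: "real \<Rightarrow> real" where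
  "taylor_coeff x = (sqrt (1 + x) + 2) / (2 * sqrt (1 + x) * (sqrt (1 + x) + 1)\<^sup>2)"

lemma inverse_sqrt_one_plus:
  fixes x :: real
  assumes "x \<ge> 0"
  shows "1 / sqrt (1 + x) = 1 - x / 2 +
    x\<^sup>2 * taylor_coeff x"
proof -
  define t where "t = sqrt (1 + x)"
  have t: "t \<ge> 1" "x = (t - 1) * (t + 1)" using assms by (auto simp: t_def algebra_simps)
  show ?thesis
    unfolding taylor_coeff_def t_def[symmetric] t(2) using t(1)
    by (simp add: power_mult_distrib field_simps) (simp add: algebra_simps power2_eq_square power3_eq_cube power4_eq_xxxx)
qed

lemma taylor_coeff_bounds:
  assumes "x \<ge> 0"
  shows "0 \<le> taylor_coeff x" "taylor_coeff x \<le> 3 / 8"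
proof -
  define t where "t = sqrt (1 + x)"
  have t: "t \<ge> 1" using assms by (simp add: t_def)
  show "0 \<le> taylor_coeff x" using t unfolding taylor_coeff_def t_def[symmetric] by simp
  have "(1 + 1)\<^sup>2 \<le> (t + 1)\<^sup>2" using t by (intro power_mono) auto
  then have "2 * t * 4 \<le> 2 * t * (t + 1)\<^sup>2" using t by (intro mult_left_mono) auto
  then have "(t + 2) / (2 * t * (t + 1)\<^sup>2) \<le> (3 * t) / (2 * t * 4)"
    using t by (intro frac_le) auto
  also have "\<dots> = 3 / 8" using t by simp
  finally show "taylor_coeff x \<le> 3 / 8" unfolding taylor_coeff_def t_def[symmetric] .
qed

definition first_order :: "real \<Rightarrow> real \<Rightarrow> real" where
  "first_order p \<alpha> = integral {0..1} (\<lambda>s. pert \<alpha> s / lead p s powr (3/2))"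

definition second_order :: "real \<Rightarrow> real \<Rightarrow> real" where
  "second_order p \<alpha> = integral {0..1} (\<lambda>s. (pert \<alpha> s)\<^sup>2 / lead p s powr (5/2) *
     taylor_coeff ((p + 1) * \<alpha> powr (1 - p) * (pert \<alpha> s / lead p s)))"

lemma measurable_taylor_coeff [measurable]: "taylor_coeff \<in> borel_measurable borel"
  unfolding taylor_coeff_def by measurable

text \<open>
Since \<open>0 \<le> pert \<alpha> s \<le> lead p s\<close>, the quotient \<open>pert \<alpha> s / lead p s\<close> is at most 1. The bound
does not involve \<open>\<alpha>\<close>, so it also serves as the majorant when \<open>\<alpha>\<close> tends to infinity.
\<close>

lemma second_order_integrand_bound:
  assumes p: "p > 1" and \<alpha>: "\<alpha> > 0" and s: "0 \<le> s" "s < 1"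
  shows "\<bar>(pert \<alpha> s)\<^sup>2 / lead p s powr (5/2) *
     taylor_coeff ((p + 1) * \<alpha> powr (1 - p) * (pert \<alpha> s / lead p s))\<bar> \<le> (3 / 8) / sqrt (lead p s)"
proof -
  have A: "lead p s > 0" using lead_pos[OF p] s by auto
  have B: "0 \<le> pert \<alpha> s" "pert \<alpha> s \<le> lead p s"
    using pert_bounds[OF \<alpha>] pert_le_lead[OF p \<alpha>] s by auto
  have "(pert \<alpha> s)\<^sup>2 / lead p s powr (5/2) = (pert \<alpha> s / lead p s)\<^sup>2 / sqrt (lead p s)"
    using A by (simp add: powr_5_2 power_divide)
  moreover have "(pert \<alpha> s / lead p s)\<^sup>2 \<le> 1"
    using A B by (intro power_le_one) auto
  ultimately have "(pert \<alpha> s)\<^sup>2 / lead p s powr (5/2) \<le> 1 / sqrt (lead p s)"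
    using A by (simp add: divide_right_mono)
  moreover note taylor_coeff_bounds[of "(p + 1) * \<alpha> powr (1 - p) * (pert \<alpha> s / lead p s)"]
  moreover have "0 \<le> (p + 1) * \<alpha> powr (1 - p) * (pert \<alpha> s / lead p s)"
    using A B p by simp
  ultimately have "\<bar>(pert \<alpha> s)\<^sup>2 / lead p s powr (5/2) *
     taylor_coeff ((p + 1) * \<alpha> powr (1 - p) * (pert \<alpha> s / lead p s))\<bar> \<le> 1 / sqrt (lead p s) * (3/8)"
    unfolding abs_mult using A by (intro mult_mono) auto
  then show ?thesis by simp
qed

lemma second_order_integrable:
  assumes "p > 1" "\<alpha> > 0"
  shows "(\<lambda>s. (pert \<alpha> s)\<^sup>2 / lead p s powr (5/2) *
     taylor_coeff ((p + 1) * \<alpha> powr (1 - p) * (pert \<alpha> s / lead p s))) integrable_on {0..1}"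
  by (rule integrable_dominated_by_lead[OF assms(1) _ second_order_integrand_bound[OF assms]])
     (auto simp: lead_def)

lemma pert_integrable:
  assumes "p > 1" "\<alpha> > 0"
  shows "(\<lambda>s. pert \<alpha> s / lead p s powr (3/2)) integrable_on {0..1}"
  using pert_bounds[OF assms(2)] by (intro integrable_over_lead_3_2[OF assms(1), of _ 1]) auto

text \<open>
This is an identity rather than an approximation: the Taylor remainder of
\<open>1 / sqrt (lead p s + (p + 1) * \<alpha> powr (1 - p) * pert \<alpha> s)\<close> is kept inside \<open>second_order\<close>.
All asymptotics is thereby moved into the behaviour of the two coefficients.
\<close>

lemma time_map_expansion:
  assumes p: "p > 1" and \<alpha>: "\<alpha> > 0"
  shows "time_map p \<alpha> = C0 p - (p + 1) / 2 * first_order p \<alpha> * \<alpha> powr (1 - p)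
    + (p + 1)\<^sup>2 * second_order p \<alpha> * \<alpha> powr (2 * (1 - p))"
proof -
  define \<epsilon> where "\<epsilon> = (p + 1) * \<alpha> powr (1 - p)"
  have \<epsilon>: "\<epsilon> > 0" using p \<alpha> by (simp add: \<epsilon>_def)
  let ?R = "\<lambda>s. (pert \<alpha> s)\<^sup>2 / lead p s powr (5/2) * taylor_coeff (\<epsilon> * (pert \<alpha> s / lead p s))"
  have eq: "1 / sqrt (gap p \<alpha> s) = 1 / sqrt (lead p s) - \<epsilon> / 2 * (pert \<alpha> s / lead p s powr (3/2)) + \<epsilon>\<^sup>2 * ?R s"
    if "s \<in> {0..1}" for s
  proof (cases "s = 1")
    case False
    have A: "lead p s > 0" using lead_pos[OF p] that False by auto
    have B: "0 \<le> pert \<alpha> s" using pert_bounds[OF \<alpha>] that by auto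
    define x where "x = \<epsilon> * (pert \<alpha> s / lead p s)"
    have x: "x \<ge> 0" using A B \<epsilon> by (simp add: x_def)
    have "gap p \<alpha> s = lead p s * (1 + x)"
      using A by (simp add: gap_def x_def \<epsilon>_def field_simps)
    then have "1 / sqrt (gap p \<alpha> s) = 1 / sqrt (lead p s) * (1 / sqrt (1 + x))"
      by (simp add: real_sqrt_mult)
    also have "\<dots> = 1 / sqrt (lead p s) - x / (2 * sqrt (lead p s)) + x\<^sup>2 / sqrt (lead p s) * taylor_coeff x"
      unfolding inverse_sqrt_one_plus[OF x] by (simp add: ring_distribs)
    also have "x / (2 * sqrt (lead p s)) = \<epsilon> / 2 * (pert \<alpha> s / lead p s powr (3/2))"
      using A by (simp add: x_def powr_3_2)
    also have "x\<^sup>2 / sqrt (lead p s) = \<epsilon>\<^sup>2 * ((pert \<alpha> s)\<^sup>2 / lead p s powr (5/2))"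
      using A by (simp add: x_def powr_5_2 power_mult_distrib power_divide)
    finally show ?thesis by (simp add: x_def mult.assoc)
  qed auto
  have "((\<lambda>s. 1 / sqrt (lead p s) - \<epsilon> / 2 * (pert \<alpha> s / lead p s powr (3/2)) + \<epsilon>\<^sup>2 * ?R s) has_integral
     C0 p - \<epsilon> / 2 * first_order p \<alpha> + \<epsilon>\<^sup>2 * second_order p \<alpha>) {0..1}"
    unfolding C0_def first_order_def second_order_def lead_def[symmetric] \<epsilon>_def
    by (intro has_integral_add has_integral_diff has_integral_mult_right integrable_integral
        integrable_inverse_sqrt_lead pert_integrable second_order_integrable p \<alpha>)
  then have "((\<lambda>s. 1 / sqrt (gap p \<alpha> s)) has_integral
     C0 p - \<epsilon> / 2 * first_order p \<alpha> + \<epsilon>\<^sup>2 * second_order p \<alpha>) {0..1}"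
    by (rule has_integral_eq[rotated]) (use eq in auto)
  then have "time_map p \<alpha> = C0 p - \<epsilon> / 2 * first_order p \<alpha> + \<epsilon>\<^sup>2 * second_order p \<alpha>"
    unfolding time_map_def by (rule integral_unique)
  moreover have "(\<alpha> powr (1 - p))\<^sup>2 = \<alpha> powr (2 * (1 - p))"
    using \<alpha> by (simp add: powr_power mult.commute)
  ultimately show ?thesis by (simp add: \<epsilon>_def power_mult_distrib mult_ac)
qed

lemma pert_tendsto:
  assumes "filterlim X at_top F"
  shows "((\<lambda>n. pert (X n) s) \<longlongrightarrow> (1 - s\<^sup>2) / 4) F"
proof -
  have inv: "((\<lambda>n. inverse (X n)) \<longlongrightarrow> 0) F"
    by (rule tendsto_inverse_0_at_top[OF assms])
  have bdd: "((\<lambda>n. f n * inverse (X n)) \<longlongrightarrow> 0) F" if "\<And>n. \<bar>f n\<bar> \<le> K" for f and K :: real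
  proof (rule Lim_null_comparison)
    show "((\<lambda>n. K * \<bar>inverse (X n)\<bar>) \<longlongrightarrow> 0) F"
      using tendsto_mult_right_zero[OF tendsto_rabs_zero[OF inv]] .
    show "\<forall>\<^sub>F n in F. norm (f n * inverse (X n)) \<le> K * \<bar>inverse (X n)\<bar>"
      unfolding real_norm_def abs_mult using that by (intro always_eventually allI mult_right_mono) auto
  qed
  have "((\<lambda>n. (1 - s\<^sup>2) / 4
      - 1 / 4 * ((sin (2 * X n) - s * sin (2 * X n * s)) * inverse (X n))
      - 1 / 8 * ((cos (2 * X n) - cos (2 * X n * s)) * inverse (X n)) * inverse (X n))
      \<longlongrightarrow> (1 - s\<^sup>2) / 4 - 1 / 4 * 0 - 1 / 8 * 0 * 0) F"
  proof (intro tendsto_diff tendsto_mult tendsto_const bdd inv)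
    show "\<bar>sin (2 * X n) - s * sin (2 * X n * s)\<bar> \<le> 1 + \<bar>s\<bar> * 1" for n
      by (rule order_trans[OF abs_triangle_ineq4])
         (unfold abs_mult, intro add_mono mult_left_mono abs_sin_le_one abs_ge_zero)
    show "\<bar>cos (2 * X n) - cos (2 * X n * s)\<bar> \<le> 1 + 1" for n
      by (rule order_trans[OF abs_triangle_ineq4]) (intro add_mono abs_cos_le_one)
  qed
  moreover have "pert x s = (1 - s\<^sup>2) / 4
      - 1 / 4 * ((sin (2 * x) - s * sin (2 * x * s)) * inverse x)
      - 1 / 8 * ((cos (2 * x) - cos (2 * x * s)) * inverse x) * inverse x" for x
    by (cases "x = 0") (simp_all add: pert_def power2_eq_square inverse_eq_divide)
  ultimately show ?thesis by simp
qed

text \<open>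
Dominated convergence: the oscillating terms of \<open>pert\<close> carry negative powers of \<open>\<alpha>\<close>, and the
argument of \<open>taylor_coeff\<close> tends to 0. The constant \<open>3/128\<close> in \<open>C2\<close> is
\<open>taylor_coeff 0 = 3/8\<close> times the square of the factor \<open>1/4\<close> in the limit of \<open>pert\<close>.
\<close>

lemma second_order_tendsto:
  assumes p: "p > 1"
  shows "((\<lambda>\<alpha>. (p + 1)\<^sup>2 * second_order p \<alpha>) \<longlongrightarrow> C2 p) at_top"
proof -
  have lim: "(second_order p \<longlongrightarrow>
     integral {0..1} (\<lambda>s. ((1 - s\<^sup>2) / 4)\<^sup>2 / lead p s powr (5/2) * taylor_coeff 0)) at_top"
  proof (rule tendsto_at_topI_sequentially)
    fix X :: "nat \<Rightarrow> real" assume X: "filterlim X at_top sequentially"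
    \<comment> \<open>Dominated convergence wants the majorant for every index, hence a positive sequence.\<close>
    define Y where "Y n = max 1 (X n)" for n
    have Y: "filterlim Y at_top sequentially"
      by (rule filterlim_at_top_mono[OF X]) (auto simp: Y_def)
    have Ypos: "Y n > 0" for n by (auto simp: Y_def)
    have "(\<lambda>n. second_order p (Y n)) \<longlonglongrightarrow>
      integral {0..1} (\<lambda>s. ((1 - s\<^sup>2) / 4)\<^sup>2 / lead p s powr (5/2) * taylor_coeff 0)"
      unfolding second_order_def
    proof (rule dominated_convergence(2))
      show "(\<lambda>s. (3 / 8) * (1 / sqrt (lead p s))) integrable_on {0..1}"
        using integrable_cmul[OF integrable_inverse_sqrt_lead[OF p], of "3/8"] by simp
      fix n
      show "(\<lambda>s. (pert (Y n) s)\<^sup>2 / lead p s powr (5/2) *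
         taylor_coeff ((p + 1) * Y n powr (1 - p) * (pert (Y n) s / lead p s))) integrable_on {0..1}"
        by (rule second_order_integrable[OF p Ypos])
      fix s :: real assume s: "s \<in> {0..1}"
      show "norm ((pert (Y n) s)\<^sup>2 / lead p s powr (5/2) *
         taylor_coeff ((p + 1) * Y n powr (1 - p) * (pert (Y n) s / lead p s)))
         \<le> (3 / 8) * (1 / sqrt (lead p s))"
        using second_order_integrand_bound[OF p Ypos, of s n] s by (cases "s = 1") auto
    next
      fix s :: real assume s: "s \<in> {0..1}"
      have "(\<lambda>n. Y n powr (1 - p)) \<longlonglongrightarrow> 0"
        using p by (intro tendsto_neg_powr Y) auto
      then have "(\<lambda>n. (p + 1) * Y n powr (1 - p) * (pert (Y n) s / lead p s))
          \<longlonglongrightarrow> (p + 1) * 0 * ((1 - s\<^sup>2) / 4 / lead p s)"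
        unfolding divide_inverse[of _ "lead p s"]
        by (intro tendsto_mult tendsto_const pert_tendsto[OF Y])
      then have "(\<lambda>n. (p + 1) * Y n powr (1 - p) * (pert (Y n) s / lead p s)) \<longlonglongrightarrow> 0"
        by simp
      moreover have "isCont taylor_coeff 0"
        unfolding taylor_coeff_def by (intro continuous_intros) auto
      ultimately have "(\<lambda>n. taylor_coeff ((p + 1) * Y n powr (1 - p) * (pert (Y n) s / lead p s)))
          \<longlonglongrightarrow> taylor_coeff 0"
        by (rule isCont_tendsto_compose[rotated])
      then show "(\<lambda>n. (pert (Y n) s)\<^sup>2 / lead p s powr (5/2) *
         taylor_coeff ((p + 1) * Y n powr (1 - p) * (pert (Y n) s / lead p s)))
          \<longlonglongrightarrow> ((1 - s\<^sup>2) / 4)\<^sup>2 / lead p s powr (5/2) * taylor_coeff 0"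
        unfolding divide_inverse[of _ "lead p s powr _"]
        by (intro tendsto_mult tendsto_power tendsto_const pert_tendsto[OF Y])
    qed
    moreover have "\<forall>\<^sub>F n in sequentially. second_order p (Y n) = second_order p (X n)"
      using X[unfolded filterlim_at_top, rule_format, of 1] by eventually_elim (simp add: Y_def max_def)
    ultimately show "(\<lambda>n. second_order p (X n)) \<longlonglongrightarrow>
      integral {0..1} (\<lambda>s. ((1 - s\<^sup>2) / 4)\<^sup>2 / lead p s powr (5/2) * taylor_coeff 0)"
      by (rule Lim_transform_eventually)
  qed
  have "(\<lambda>s. ((1 - s\<^sup>2) / 4)\<^sup>2 / lead p s powr (5/2) * taylor_coeff 0)
      = (\<lambda>s. 3 / 128 * ((1 - s\<^sup>2)\<^sup>2 / lead p s powr (5/2)))"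
    by (rule ext) (simp add: taylor_coeff_def power_divide)
  then have "C2 p = (p + 1)\<^sup>2 *
      integral {0..1} (\<lambda>s. ((1 - s\<^sup>2) / 4)\<^sup>2 / lead p s powr (5/2) * taylor_coeff 0)"
    by (simp add: C2_def lead_def[symmetric] del: times_divide_eq_left times_divide_eq_right)
  then show ?thesis using tendsto_mult[OF tendsto_const lim] by simp
qed

section \<open>Integration by parts at the singularity\<close>

text \<open>
On \<open>[0, pi/2]\<close> one has \<open>1 \<le> cos \<theta> + sin \<theta>\<close>. Multiplying by \<open>sin \<theta> powr a\<close> gives a majorant
whose first term has an explicit primitive and whose second term is continuous.
\<close>

lemma integrable_sin_powr:
  fixes a :: real
  assumes a: "a > -1"
  shows "(\<lambda>\<theta>. sin \<theta> powr a) integrable_on {0..pi/2}"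
proof (rule integrable_borel_dominated)
  have cont: "continuous_on {0..pi/2} (\<lambda>\<theta>. sin \<theta> powr (a + 1))"
    using a by (intro continuous_on_powr' continuous_intros) (auto intro!: sin_ge_zero)
  have "((\<lambda>\<theta>. sin \<theta> powr a * cos \<theta>) has_integral
      sin (pi/2) powr (a + 1) / (a + 1) - sin 0 powr (a + 1) / (a + 1)) {0..pi/2}"
  proof (rule fundamental_theorem_of_calculus_interior)
    show "continuous_on {0..pi/2} (\<lambda>\<theta>. sin \<theta> powr (a + 1) / (a + 1))"
      using a by (intro continuous_on_divide cont continuous_on_const) auto
    fix \<theta> :: real assume "\<theta> \<in> {0<..<pi/2}"
    then have "sin \<theta> > 0" by (auto intro: sin_gt_zero)
    then have "((\<lambda>\<theta>. sin \<theta> powr (a + 1)) has_real_derivative (a + 1) * sin \<theta> powr a * cos \<theta>) (at \<theta>)"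
      using DERIV_fun_powr[OF DERIV_sin, of \<theta> "a + 1"] by simp
    from DERIV_cdivide[OF this, of "a + 1"]
    show "((\<lambda>\<theta>. sin \<theta> powr (a + 1) / (a + 1)) has_vector_derivative sin \<theta> powr a * cos \<theta>) (at \<theta>)"
      using a by (simp add: has_real_derivative_iff_has_vector_derivative mult.assoc)
  qed auto
  then show "(\<lambda>\<theta>. sin \<theta> powr a * cos \<theta> + sin \<theta> powr (a + 1)) integrable_on {0..pi/2}"
    by (intro integrable_add[OF has_integral_integrable integrable_continuous_real] cont)
  fix \<theta> :: real assume \<theta>: "\<theta> \<in> {0..pi/2}"
  have s: "0 \<le> sin \<theta>" "0 \<le> cos \<theta>" using \<theta> by (auto intro!: sin_ge_zero cos_ge_zero)
  have "1\<^sup>2 \<le> (cos \<theta> + sin \<theta>)\<^sup>2"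
    using s by (simp add: power2_sum)
  then have "1 \<le> cos \<theta> + sin \<theta>" by (rule power2_le_imp_le) (use s in auto)
  then have "sin \<theta> powr a * 1 \<le> sin \<theta> powr a * (cos \<theta> + sin \<theta>)"
    by (intro mult_left_mono) auto
  also have "\<dots> = sin \<theta> powr a * cos \<theta> + sin \<theta> powr (a + 1)"
    using s by (cases "sin \<theta> = 0") (auto simp: powr_add algebra_simps)
  finally show "\<bar>sin \<theta> powr a\<bar> \<le> sin \<theta> powr a * cos \<theta> + sin \<theta> powr (a + 1)" by simp
qed auto

lemma bounded_times_sin_powr:
  fixes a :: real
  assumes a: "a > -1" and [measurable]: "h \<in> borel_measurable borel"
    and h: "\<And>\<theta>. \<theta> \<in> {0..pi/2} \<Longrightarrow> \<bar>h \<theta>\<bar> \<le> M"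
  shows "(\<lambda>\<theta>. h \<theta> * sin \<theta> powr a) integrable_on {0..pi/2}"
    and "\<bar>integral {0..pi/2} (\<lambda>\<theta>. h \<theta> * sin \<theta> powr a)\<bar> \<le> M * integral {0..pi/2} (\<lambda>\<theta>. sin \<theta> powr a)"
proof -
  have int: "(\<lambda>\<theta>. M * sin \<theta> powr a) integrable_on {0..pi/2}"
    using integrable_cmul[OF integrable_sin_powr[OF a], of M] by simp
  have bound: "\<bar>h \<theta> * sin \<theta> powr a\<bar> \<le> M * sin \<theta> powr a" if "\<theta> \<in> {0..pi/2}" for \<theta>
    using h[OF that] by (simp add: abs_mult mult_right_mono)
  show *: "(\<lambda>\<theta>. h \<theta> * sin \<theta> powr a) integrable_on {0..pi/2}"
    by (rule integrable_borel_dominated[OF _ int bound]) auto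
  have "norm (integral {0..pi/2} (\<lambda>\<theta>. h \<theta> * sin \<theta> powr a)) \<le> integral {0..pi/2} (\<lambda>\<theta>. M * sin \<theta> powr a)"
    by (rule integral_norm_bound_integral[OF * int]) (use bound in auto)
  then show "\<bar>integral {0..pi/2} (\<lambda>\<theta>. h \<theta> * sin \<theta> powr a)\<bar> \<le> M * integral {0..pi/2} (\<lambda>\<theta>. sin \<theta> powr a)"
    by simp
qed

text \<open>
The substitution \<open>s = \<sigma> \<theta> = sin \<theta> powr (2 / (p + 1))\<close> turns \<open>lead p s\<close> into \<open>(cos \<theta>)\<^sup>2\<close>, and
\<open>1 / (cos \<theta>)\<^sup>2\<close> is the derivative of \<open>tan \<theta>\<close>, which allows an integration by parts. This trades
the singularity at \<open>s = 1\<close> for a derivative of \<open>g\<close>, which for \<open>g s = sin (2 * \<alpha> * s)\<close> extracts the factor \<open>\<alpha>\<close>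
that raises the order of the term.

Both steps are carried out at once. With \<open>\<Phi>\<close> the primitive of the left integrand and
\<open>H \<theta>\<close> the boundary term, \<open>\<Phi> (\<sigma> \<theta>) - 2 / (p + 1) * H \<theta>\<close> is continuous on the closed interval
and has the right integrand as derivative inside; the fundamental theorem for the gauge integral
asks for nothing more.
\<close>

lemma singular_integral_by_parts:
  fixes p :: real and g g' :: "real \<Rightarrow> real"
  assumes p: "p > 1"
    and dg: "\<And>s. (g has_real_derivative g' s) (at s)"
    and [measurable]: "g' \<in> borel_measurable borel"
    and L: "\<And>s. \<bar>g' s\<bar> \<le> L"
  shows "(\<lambda>s. (g 1 - g s) / lead p s powr (3/2)) integrable_on {0..1}" (is ?int)
    and "integral {0..1} (\<lambda>s. (g 1 - g s) / lead p s powr (3/2)) =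
      4 / (p + 1)\<^sup>2 * integral {0..pi/2}
        (\<lambda>\<theta>. g' (sin \<theta> powr (2 / (p + 1))) * sin \<theta> powr ((3 - p) / (p + 1)))
      + 2 * (p - 1) / (p + 1)\<^sup>2 * integral {0..pi/2}
        (\<lambda>\<theta>. (g 1 - g (sin \<theta> powr (2 / (p + 1)))) * sin \<theta> powr ((1 - p) / (p + 1)))"
      (is "?I = 4 / (p + 1)\<^sup>2 * ?I1 + 2 * (p - 1) / (p + 1)\<^sup>2 * ?I2")
proof -
  have contg: "continuous_on S g" for S
    using dg by (meson DERIV_isCont continuous_at_imp_continuous_on)
  have [measurable]: "g \<in> borel_measurable borel"
    by (rule borel_measurable_continuous_onI[OF contg])
  have lip: "\<bar>g 1 - g s\<bar> \<le> L * (1 - s)" if "s \<le> 1" for s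
  proof (cases "s = 1")
    case False
    then obtain z where "g 1 - g s = (1 - s) * g' z"
      using MVT2[of s 1 g g'] dg \<open>s \<le> 1\<close> by auto
    then show ?thesis using L[of z] that by (simp add: abs_mult mult.commute mult_right_mono)
  qed auto
  have L0: "0 \<le> L" using L[of 0] by linarith
  show int: ?int
    by (rule integrable_over_lead_3_2[OF p, where M = L]) (use lip in auto)

  define k where "k = 2 / (p + 1)"
  define \<sigma> where "\<sigma> \<theta> = sin \<theta> powr k" for \<theta>
  have k: "k > 0" using p by (simp add: k_def)
  have k': "(1 - p) / (p + 1) = k - 1" "(3 - p) / (p + 1) = 2 * k - 1" "(p - 1) / (p + 1) = 1 - k"
    using p by (simp_all add: k_def field_simps)
  have \<sigma>01: "0 \<le> \<sigma> \<theta>" "\<sigma> \<theta> \<le> 1" if "\<theta> \<in> {0..pi/2}" for \<theta>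
    using that k powr_mono2[of k "sin \<theta>" 1] sin_ge_zero[of \<theta>] by (auto simp: \<sigma>_def)
  have lead\<sigma>: "lead p (\<sigma> \<theta>) = (cos \<theta>)\<^sup>2" if "\<theta> \<in> {0..pi/2}" for \<theta>
  proof -
    have "k * (p + 1) = 2" using p by (simp add: k_def field_simps)
    moreover have "0 \<le> sin \<theta>" using that by (auto intro!: sin_ge_zero)
    ultimately have "\<sigma> \<theta> powr (p + 1) = (sin \<theta>)\<^sup>2"
      by (cases "sin \<theta> = 0") (simp_all add: \<sigma>_def powr_powr)
    then show ?thesis by (simp add: lead_def cos_squared_eq)
  qed
  have cont\<sigma>: "continuous_on {0..pi/2} \<sigma>"
    unfolding \<sigma>_def using k by (intro continuous_on_powr' continuous_intros) (auto intro!: sin_ge_zero)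

  let ?f = "\<lambda>s. (g 1 - g s) / lead p s powr (3/2)"
  define \<Phi> where "\<Phi> y = integral {0..y} ?f" for y
  define H where "H \<theta> = (g 1 - g (\<sigma> \<theta>)) * \<sigma> \<theta> / cos \<theta>" for \<theta>
  \<comment> \<open>The Lipschitz bound at 1 beats the zero of the cosine, so \<open>H\<close> vanishes at \<open>pi/2\<close>.\<close>
  have Hbound: "\<bar>H \<theta>\<bar> \<le> L * cos \<theta>" if \<theta>: "\<theta> \<in> {0..pi/2}" for \<theta>
  proof -
    have c: "0 \<le> cos \<theta>" using \<theta> by (auto intro!: cos_ge_zero)
    have "\<bar>g 1 - g (\<sigma> \<theta>)\<bar> * \<sigma> \<theta> \<le> L * (cos \<theta>)\<^sup>2 * 1"
    proof (rule mult_mono)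
      have "\<bar>g 1 - g (\<sigma> \<theta>)\<bar> \<le> L * (1 - \<sigma> \<theta>)" using lip \<sigma>01[OF \<theta>] by blast
      also have "\<dots> \<le> L * lead p (\<sigma> \<theta>)"
        using lead_ge[OF p \<sigma>01[OF \<theta>]] L0 by (intro mult_left_mono) auto
      finally show "\<bar>g 1 - g (\<sigma> \<theta>)\<bar> \<le> L * (cos \<theta>)\<^sup>2" using lead\<sigma>[OF \<theta>] by simp
    qed (use \<sigma>01[OF \<theta>] L0 in auto)
    then show ?thesis using c \<sigma>01[OF \<theta>]
      by (cases "cos \<theta> = 0") (simp_all add: H_def abs_mult pos_divide_le_eq power2_eq_square mult.assoc)
  qed
  have contH: "continuous_on {0..pi/2} H"
    unfolding continuous_on_eq_continuous_within
  proof
    fix \<theta> :: real assume \<theta>: "\<theta> \<in> {0..pi/2}"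
    show "continuous (at \<theta> within {0..pi/2}) H"
    proof (cases "\<theta> = pi/2")
      case True
      have "((\<lambda>t. L * cos t) \<longlongrightarrow> L * cos (pi/2)) (at (pi/2) within {0..pi/2})"
        by (intro tendsto_intros)
      then have "(H \<longlongrightarrow> 0) (at (pi/2) within {0..pi/2})"
        by (intro Lim_null_comparison[of H "\<lambda>t. L * cos t"])
           (auto simp: eventually_at_filter intro!: always_eventually Hbound)
      then show ?thesis unfolding True continuous_within by (simp add: H_def)
    next
      case False
      then have "cos \<theta> \<noteq> 0" using \<theta> cos_gt_zero_pi[of \<theta>] by auto
      moreover have c\<sigma>: "continuous (at \<theta> within {0..pi/2}) \<sigma>"
        using cont\<sigma> \<theta> by (auto simp: continuous_on_eq_continuous_within)
      moreover have "continuous (at \<theta> within {0..pi/2}) (\<lambda>\<theta>. g (\<sigma> \<theta>))"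
        using continuous_within_compose3[OF DERIV_isCont[OF dg] c\<sigma>] .
      ultimately show ?thesis unfolding H_def
        by (intro continuous_intros) auto
    qed
  qed
  let ?J1 = "\<lambda>\<theta>. g' (\<sigma> \<theta>) * sin \<theta> powr ((3 - p) / (p + 1))"
  let ?J2 = "\<lambda>\<theta>. (g 1 - g (\<sigma> \<theta>)) * sin \<theta> powr ((1 - p) / (p + 1))"
  have "((\<lambda>\<theta>. k * (k * ?J1 \<theta> + (1 - k) * ?J2 \<theta>)) has_integral
      (\<Phi> (\<sigma> (pi/2)) - k * H (pi/2)) - (\<Phi> (\<sigma> 0) - k * H 0)) {0..pi/2}"
  proof (rule fundamental_theorem_of_calculus_interior)
    have "continuous_on {0..pi/2} (\<lambda>\<theta>. \<Phi> (\<sigma> \<theta>))"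
      by (rule continuous_on_compose2[OF _ cont\<sigma>, of "{0..1}"])
         (use \<sigma>01 in \<open>auto simp: \<Phi>_def intro!: indefinite_integral_continuous_1 int\<close>)
    then show "continuous_on {0..pi/2} (\<lambda>\<theta>. \<Phi> (\<sigma> \<theta>) - k * H \<theta>)"
      by (intro continuous_intros contH)
    fix \<theta> :: real assume \<theta>: "\<theta> \<in> {0<..<pi/2}"
    then have \<theta>': "\<theta> \<in> {0..pi/2}" by auto
    define S C s D where "S = sin \<theta>" and "C = cos \<theta>" and "s = \<sigma> \<theta>" and "D = g 1 - g s"
    have SC: "S > 0" "C > 0" "S\<^sup>2 + C\<^sup>2 = 1"
      using \<theta> by (auto simp: S_def C_def intro!: sin_gt_zero cos_gt_zero)
    have s: "s > 0" "s \<le> 1" "lead p s = C\<^sup>2"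
      using SC \<sigma>01(2)[OF \<theta>'] lead\<sigma>[OF \<theta>'] by (auto simp: s_def \<sigma>_def S_def C_def)
    have "s \<noteq> 1" using s SC by auto
    then have s1: "s < 1" using s by simp
    have d\<sigma>: "(\<sigma> has_real_derivative k * s * C / S) (at \<theta>)"
      using DERIV_fun_powr[OF DERIV_sin, of \<theta> k] SC
      unfolding \<sigma>_def[abs_def] by (simp add: S_def C_def s_def \<sigma>_def powr_diff mult_ac)
    have "lead p s powr (3/2) = C ^ 3"
      using s SC by (simp add: powr_3_2 power2_eq_square power3_eq_cube)
    moreover have "isCont ?f s"
    proof -
      have "isCont (lead p) s"
        unfolding lead_def using s by (intro continuous_intros) auto
      moreover have "isCont g s" using dg DERIV_isCont by blast
      ultimately show ?thesis using s SC by (intro continuous_intros) auto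
    qed
    ultimately have "(\<Phi> has_real_derivative D / C ^ 3) (at s)"
      unfolding \<Phi>_def D_def using has_real_derivative_integral[OF int s(1) s1] by simp
    then have d\<Phi>: "((\<lambda>\<theta>. \<Phi> (\<sigma> \<theta>)) has_real_derivative D / C ^ 3 * (k * s * C / S)) (at \<theta>)"
      unfolding s_def by (rule DERIV_chain2) (use d\<sigma> in \<open>simp add: s_def\<close>)
    have dg\<sigma>: "((\<lambda>\<theta>. g (\<sigma> \<theta>)) has_real_derivative g' s * (k * s * C / S)) (at \<theta>)"
      unfolding s_def by (rule DERIV_chain2[OF dg]) (use d\<sigma> in \<open>simp add: s_def\<close>)
    have dH: "(H has_real_derivative
       ((0 - g' s * (k * s * C / S)) * s + k * s * C / S * D) / C + D * s * S / C\<^sup>2) (at \<theta>)"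
    proof -
      have "(H has_real_derivative
       (((0 - g' s * (k * s * C / S)) * \<sigma> \<theta> + k * s * C / S * (g 1 - g (\<sigma> \<theta>))) * cos \<theta>
          - ((g 1 - g (\<sigma> \<theta>)) * \<sigma> \<theta>) * (- sin \<theta>)) / (cos \<theta> * cos \<theta>)) (at \<theta>)"
        unfolding H_def[abs_def]
        by (intro DERIV_divide DERIV_mult DERIV_diff DERIV_const dg\<sigma> d\<sigma> DERIV_cos)
           (use SC in \<open>auto simp: C_def\<close>)
      then show ?thesis
        by (rule DERIV_cong)
           (use SC(2) in \<open>simp add: s_def[symmetric] D_def[symmetric] S_def[symmetric] C_def[symmetric]
              diff_divide_distrib add_divide_distrib power2_eq_square\<close>)
    qed
    have J1: "?J1 \<theta> = g' s * s\<^sup>2 / S"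
      using SC unfolding k' s_def[symmetric]
      by (simp add: s_def \<sigma>_def S_def powr_diff powr_add[symmetric] power2_eq_square mult_2[symmetric])
    have J2: "?J2 \<theta> = D * s / S"
      using SC unfolding k' D_def s_def[symmetric]
      by (simp add: s_def \<sigma>_def S_def powr_diff)
    have "D / C ^ 3 * (k * s * C / S)
        - k * (((0 - g' s * (k * s * C / S)) * s + k * s * C / S * D) / C + D * s * S / C\<^sup>2)
        = k * (k * (g' s * s\<^sup>2 / S) + (1 - k) * (D * s / S))"
    proof -
      have C2: "1 - S\<^sup>2 = C\<^sup>2" using SC(3) by simp
      have "1 / (S * C\<^sup>2) - S / C\<^sup>2 = (1 - S\<^sup>2) / (S * C\<^sup>2)"
        using SC(1,2) by (simp add: field_simps power2_eq_square)
      then have a: "1 / (S * C\<^sup>2) - S / C\<^sup>2 = 1 / S"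
        unfolding C2 using SC(2) by simp
      have "D / C ^ 3 * (k * s * C / S)
        - k * (((0 - g' s * (k * s * C / S)) * s + k * s * C / S * D) / C + D * s * S / C\<^sup>2)
        = k * D * s * (1 / (S * C\<^sup>2) - S / C\<^sup>2) + k\<^sup>2 * g' s * s\<^sup>2 / S - k\<^sup>2 * s * D / S"
        using SC(1,2) by (simp add: field_simps power2_eq_square power3_eq_cube)
      also have "\<dots> = k * (k * (g' s * s\<^sup>2 / S) + (1 - k) * (D * s / S))"
        unfolding a using SC(1) by (simp add: field_simps power2_eq_square)
      finally show ?thesis .
    qed
    then show "((\<lambda>\<theta>. \<Phi> (\<sigma> \<theta>) - k * H \<theta>) has_vector_derivative
        k * (k * ?J1 \<theta> + (1 - k) * ?J2 \<theta>)) (at \<theta>)"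
      unfolding has_real_derivative_iff_has_vector_derivative[symmetric] J1 J2
      using DERIV_diff[OF d\<Phi> DERIV_cmult[OF dH, of k]] by simp
  qed simp
  moreover have "\<Phi> (\<sigma> (pi/2)) = ?I" "H (pi/2) = 0" "\<Phi> (\<sigma> 0) = 0" "H 0 = 0"
    by (simp_all add: \<Phi>_def \<sigma>_def H_def)
  ultimately have "((\<lambda>\<theta>. k * (k * ?J1 \<theta> + (1 - k) * ?J2 \<theta>)) has_integral ?I) {0..pi/2}"
    by simp
  then have I: "?I = integral {0..pi/2} (\<lambda>\<theta>. k * (k * ?J1 \<theta> + (1 - k) * ?J2 \<theta>))"
    by (rule integral_unique[symmetric])
  have [measurable]: "\<sigma> \<in> borel_measurable borel" unfolding \<sigma>_def by measurable
  have "?J1 integrable_on {0..pi/2}"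
    using p L by (intro bounded_times_sin_powr(1)[where M = L]) (auto simp: field_simps)
  moreover have "?J2 integrable_on {0..pi/2}"
  proof (intro bounded_times_sin_powr(1)[where M = L])
    fix \<theta> :: real assume \<theta>: "\<theta> \<in> {0..pi/2}"
    have "\<bar>g 1 - g (\<sigma> \<theta>)\<bar> \<le> L * (1 - \<sigma> \<theta>)" using lip \<sigma>01[OF \<theta>] by blast
    also have "\<dots> \<le> L" using \<sigma>01[OF \<theta>] L0 by (simp add: mult_left_le)
    finally show "\<bar>g 1 - g (\<sigma> \<theta>)\<bar> \<le> L" .
  qed (use p in \<open>auto simp: field_simps\<close>)
  ultimately have "integral {0..pi/2} (\<lambda>\<theta>. k * (k * ?J1 \<theta> + (1 - k) * ?J2 \<theta>))
      = k * (k * integral {0..pi/2} ?J1 + (1 - k) * integral {0..pi/2} ?J2)"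
    by (intro integral_unique has_integral_mult_right has_integral_add integrable_integral)
  also have "\<dots> = k\<^sup>2 * ?I1 + k * (1 - k) * ?I2"
    unfolding \<sigma>_def k_def by (simp add: algebra_simps power2_eq_square)
  also have "k\<^sup>2 = 4 / (p + 1)\<^sup>2" by (simp add: k_def power_divide)
  also have "k * (1 - k) = 2 * (p - 1) / (p + 1)\<^sup>2"
    unfolding k'(3)[symmetric] by (simp add: k_def power2_eq_square)
  finally show "?I = 4 / (p + 1)\<^sup>2 * ?I1 + 2 * (p - 1) / (p + 1)\<^sup>2 * ?I2"
    unfolding I .
qed

section \<open>The first-order coefficient\<close>

text \<open>
The part of the first-order coefficient, scaled by \<open>\<alpha>\<^sup>2\<close>, that the named constants leave over.
\<close>

definition cos_remainder :: "real \<Rightarrow> real \<Rightarrow> real" where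
  "cos_remainder p \<alpha> = (p - 1) / (8 * (p + 1)) *
     integral {0..pi/2} (\<lambda>\<theta>. (cos (2 * \<alpha>) - cos (2 * \<alpha> * sin \<theta> powr (2 / (p + 1))))
       * sin \<theta> powr ((1 - p) / (p + 1)))"

text \<open>
The difference \<open>sin (2 * \<alpha>) - s * sin (2 * \<alpha> * s)\<close> in \<open>pert\<close> is split as
\<open>(sin (2 * \<alpha>) - sin (2 * \<alpha> * s)) + (1 - s) * sin (2 * \<alpha> * s)\<close>. Integration by parts of the sine
difference produces \<open>C11\<close> and the first half of \<open>C12\<close>, the term \<open>(1 - s) * sin (2 * \<alpha> * s)\<close> is
the second half of \<open>C12\<close>, and integration by parts of the cosine difference produces \<open>C21\<close> and
\<open>cos_remainder\<close>.
\<close>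

lemma first_order_expansion:
  assumes p: "p > 1" and \<alpha>: "\<alpha> > 0"
  shows "(p + 1) / 2 * first_order p \<alpha> = - (C1 p + C11 p \<alpha> / 2
    + (C12 p \<alpha> + C21 p \<alpha>) / (2 * \<alpha>) + cos_remainder p \<alpha> / \<alpha>\<^sup>2)"
proof -
  let ?w = "\<lambda>s. lead p s powr (3/2)"
  let ?\<sigma> = "\<lambda>\<theta>. sin \<theta> powr (2 / (p + 1))"
  let ?a = "(3 - p) / (p + 1)" and ?b = "(1 - p) / (p + 1)"
  define XS where "XS = integral {0..1} (\<lambda>s. (sin (2 * \<alpha>) - sin (2 * \<alpha> * s)) / ?w s)"
  define XC where "XC = integral {0..1} (\<lambda>s. (cos (2 * \<alpha>) - cos (2 * \<alpha> * s)) / ?w s)"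
  define Y where "Y = integral {0..1} (\<lambda>s. (1 - s) / ?w s * sin (2 * \<alpha> * s))"
  define Z where "Z = integral {0..1} (\<lambda>s. (1 - s\<^sup>2) / ?w s)"
  define IC where "IC = integral {0..pi/2} (\<lambda>\<theta>. cos (2 * \<alpha> * ?\<sigma> \<theta>) * sin \<theta> powr ?a)"
  define IS where "IS = integral {0..pi/2} (\<lambda>\<theta>. sin (2 * \<alpha> * ?\<sigma> \<theta>) * sin \<theta> powr ?a)"
  define KS where "KS = integral {0..pi/2} (\<lambda>\<theta>. (sin (2 * \<alpha>) - sin (2 * \<alpha> * ?\<sigma> \<theta>)) * sin \<theta> powr ?b)"
  define KC where "KC = integral {0..pi/2} (\<lambda>\<theta>. (cos (2 * \<alpha>) - cos (2 * \<alpha> * ?\<sigma> \<theta>)) * sin \<theta> powr ?b)"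
  have "((\<lambda>s. sin (2 * \<alpha> * s)) has_real_derivative 2 * \<alpha> * cos (2 * \<alpha> * s)) (at s)" for s
    by (auto intro!: derivative_eq_intros)
  moreover have "\<bar>2 * \<alpha> * cos (2 * \<alpha> * s)\<bar> \<le> 2 * \<alpha>" for s
    using \<alpha> by (simp add: abs_mult)
  ultimately have S: "(\<lambda>s. (sin (2 * \<alpha> * 1) - sin (2 * \<alpha> * s)) / ?w s) integrable_on {0..1}"
      "XS = 4 / (p + 1)\<^sup>2 * (2 * \<alpha> * IC) + 2 * (p - 1) / (p + 1)\<^sup>2 * KS"
    using singular_integral_by_parts[OF p, of "\<lambda>s. sin (2 * \<alpha> * s)" "\<lambda>s. 2 * \<alpha> * cos (2 * \<alpha> * s)" "2 * \<alpha>"]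
    by (simp_all add: XS_def IC_def KS_def mult.assoc)
  have "((\<lambda>s. cos (2 * \<alpha> * s)) has_real_derivative - (2 * \<alpha>) * sin (2 * \<alpha> * s)) (at s)" for s
    by (auto intro!: derivative_eq_intros)
  moreover have "\<bar>- (2 * \<alpha>) * sin (2 * \<alpha> * s)\<bar> \<le> 2 * \<alpha>" for s
    using \<alpha> by (simp add: abs_mult)
  ultimately have C: "(\<lambda>s. (cos (2 * \<alpha> * 1) - cos (2 * \<alpha> * s)) / ?w s) integrable_on {0..1}"
      "XC = 4 / (p + 1)\<^sup>2 * (- (2 * \<alpha>) * IS) + 2 * (p - 1) / (p + 1)\<^sup>2 * KC"
    using singular_integral_by_parts[OF p, of "\<lambda>s. cos (2 * \<alpha> * s)" "\<lambda>s. - (2 * \<alpha>) * sin (2 * \<alpha> * s)" "2 * \<alpha>"]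
    by (simp_all add: XC_def IS_def KC_def mult.assoc)
  have "(\<lambda>s. (1 - s) * sin (2 * \<alpha> * s) / ?w s) integrable_on {0..1}"
    by (rule integrable_over_lead_3_2[OF p, of _ 1]) (auto simp: abs_mult mult_left_le)
  then have Yi: "(\<lambda>s. (1 - s) / ?w s * sin (2 * \<alpha> * s)) integrable_on {0..1}" by simp
  have Zi: "(\<lambda>s. (1 - s\<^sup>2) / ?w s) integrable_on {0..1}"
  proof (rule integrable_over_lead_3_2[OF p, of _ 2])
    fix s :: real assume s: "0 \<le> s" "s \<le> 1"
    then have "(1 + s) * (1 - s) \<le> 2 * (1 - s)" by (intro mult_right_mono) auto
    moreover have "s\<^sup>2 \<le> 1" using s by (simp add: power_le_one)
    ultimately show "\<bar>1 - s\<^sup>2\<bar> \<le> 2 * (1 - s)" by (simp add: algebra_simps power2_eq_square)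
  qed auto
  have split: "pert \<alpha> s / ?w s = 1 / 4 * ((1 - s\<^sup>2) / ?w s)
     - 1 / (4 * \<alpha>) * ((sin (2 * \<alpha> * 1) - sin (2 * \<alpha> * s)) / ?w s + (1 - s) / ?w s * sin (2 * \<alpha> * s))
     - 1 / (8 * \<alpha>\<^sup>2) * ((cos (2 * \<alpha> * 1) - cos (2 * \<alpha> * s)) / ?w s)" for s
  proof (cases "?w s = 0")
    case False
    then show ?thesis using \<alpha> unfolding pert_def by (simp add: field_simps)
  qed simp
  have fo: "first_order p \<alpha> = 1 / 4 * Z - 1 / (4 * \<alpha>) * (XS + Y) - 1 / (8 * \<alpha>\<^sup>2) * XC"
    unfolding first_order_def split
    by (rule integral_unique, intro has_integral_diff has_integral_mult_right has_integral_add)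
       (use S(1) C(1) Yi Zi in \<open>auto simp: XS_def XC_def Y_def Z_def intro: integrable_integral\<close>)
  define q where "q = p + 1"
  have q: "q > 0" using p by (simp add: q_def)
  have "- q / 2 * first_order p \<alpha>
    = - (q / 8) * Z + q / (8 * \<alpha>) * (XS + Y) + q / (16 * \<alpha>\<^sup>2) * XC"
    unfolding fo using \<alpha> by (simp add: field_simps)
  also have "\<dots> = - (q / 8) * Z + 2 / q * IC / 2
     + (((p - 1) / (2 * q) * KS + q / 4 * Y) + (- (1 / q) * IS)) / (2 * \<alpha>)
     + (p - 1) / (8 * q) * KC / \<alpha>\<^sup>2"
    unfolding S(2) C(2) q_def[symmetric]
    using \<alpha> q by (simp add: field_simps power2_eq_square)
  also have "\<dots> = C1 p + C11 p \<alpha> / 2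
      + (C12 p \<alpha> + C21 p \<alpha>) / (2 * \<alpha>) + cos_remainder p \<alpha> / \<alpha>\<^sup>2"
    unfolding q_def
    by (simp add: C1_def C11_def C12_def C21_def cos_remainder_def Z_def IC_def IS_def KS_def KC_def Y_def lead_def)
  finally have "- ((p + 1) / 2 * first_order p \<alpha>) = \<dots>"
    by (simp only: q_def minus_divide_left mult_minus_left)
  then show ?thesis by (simp only: equation_minus_iff)
qed

lemma coefficients_bounded:
  assumes p: "p > 1"
  shows "\<exists>K. \<forall>\<alpha>. \<bar>C12 p \<alpha>\<bar> \<le> K \<and> \<bar>C21 p \<alpha>\<bar> \<le> K \<and> \<bar>cos_remainder p \<alpha>\<bar> \<le> K"
proof -
  let ?\<sigma> = "\<lambda>\<theta>. sin \<theta> powr (2 / (p + 1))"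
  let ?a = "(3 - p) / (p + 1)" and ?b = "(1 - p) / (p + 1)"
  have ab: "?a > -1" "?b > -1" using p by (auto simp: field_simps)
  define A where "A = integral {0..pi/2} (\<lambda>\<theta>. sin \<theta> powr ?a)"
  define B where "B = integral {0..pi/2} (\<lambda>\<theta>. sin \<theta> powr ?b)"
  define Y where "Y = integral {0..1} (\<lambda>s. (1 - s) / lead p s powr (3/2))"
  have C12: "\<bar>C12 p \<alpha>\<bar> \<le> (p - 1) / (2 * (p + 1)) * (2 * B) + (p + 1) / 4 * Y" for \<alpha>
  proof -
    have "\<bar>integral {0..pi/2} (\<lambda>\<theta>. (sin (2 * \<alpha>) - sin (2 * \<alpha> * ?\<sigma> \<theta>)) * sin \<theta> powr ?b)\<bar> \<le> 2 * B"
      unfolding B_def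
    proof (rule bounded_times_sin_powr(2)[OF ab(2)])
      show "\<bar>sin (2 * \<alpha>) - sin (2 * \<alpha> * ?\<sigma> \<theta>)\<bar> \<le> 2" for \<theta>
        using abs_sin_le_one[of "2 * \<alpha>"] abs_sin_le_one[of "2 * \<alpha> * ?\<sigma> \<theta>"] by linarith
    qed auto
    moreover have "norm (integral {0..1} (\<lambda>s. (1 - s) / lead p s powr (3/2) * sin (2 * \<alpha> * s))) \<le> Y"
      unfolding Y_def
    proof (rule integral_norm_bound_integral)
      have "(\<lambda>s. (1 - s) * sin (2 * \<alpha> * s) / lead p s powr (3/2)) integrable_on {0..1}"
        by (rule integrable_over_lead_3_2[OF p, of _ 1]) (auto simp: abs_mult mult_left_le)
      then show "(\<lambda>s. (1 - s) / lead p s powr (3/2) * sin (2 * \<alpha> * s)) integrable_on {0..1}" by simp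
      show "(\<lambda>s. (1 - s) / lead p s powr (3/2)) integrable_on {0..1}"
        by (rule integrable_over_lead_3_2[OF p, of _ 1]) auto
      show "norm ((1 - s) / lead p s powr (3/2) * sin (2 * \<alpha> * s)) \<le> (1 - s) / lead p s powr (3/2)"
        if "s \<in> {0..1}" for s
      proof -
        have "0 \<le> (1 - s) / lead p s powr (3/2)" using that by simp
        then show ?thesis unfolding real_norm_def abs_mult by (simp only: abs_of_nonneg mult_left_le abs_sin_le_one)
      qed
    qed
    ultimately show ?thesis unfolding C12_def lead_def[symmetric] using p
      by (intro order_trans[OF abs_triangle_ineq] add_mono; unfold abs_mult; intro mult_mono) auto
  qed
  have C21: "\<bar>C21 p \<alpha>\<bar> \<le> 1 / (p + 1) * (1 * A)" for \<alpha>
  proof -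
    have "\<bar>integral {0..pi/2} (\<lambda>\<theta>. sin (2 * \<alpha> * ?\<sigma> \<theta>) * sin \<theta> powr ?a)\<bar> \<le> 1 * A"
      unfolding A_def by (rule bounded_times_sin_powr(2)[OF ab(1)]) auto
    then show ?thesis unfolding C21_def abs_mult using p by (intro mult_mono) auto
  qed
  have D: "\<bar>cos_remainder p \<alpha>\<bar> \<le> (p - 1) / (8 * (p + 1)) * (2 * B)" for \<alpha>
  proof -
    have "\<bar>integral {0..pi/2} (\<lambda>\<theta>. (cos (2 * \<alpha>) - cos (2 * \<alpha> * ?\<sigma> \<theta>)) * sin \<theta> powr ?b)\<bar> \<le> 2 * B"
      unfolding B_def
    proof (rule bounded_times_sin_powr(2)[OF ab(2)])
      show "\<bar>cos (2 * \<alpha>) - cos (2 * \<alpha> * ?\<sigma> \<theta>)\<bar> \<le> 2" for \<theta>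
        using abs_cos_le_one[of "2 * \<alpha>"] abs_cos_le_one[of "2 * \<alpha> * ?\<sigma> \<theta>"] by linarith
    qed auto
    then show ?thesis unfolding cos_remainder_def abs_mult using p by (intro mult_mono) auto
  qed
  define K where "K = Max {(p - 1) / (2 * (p + 1)) * (2 * B) + (p + 1) / 4 * Y,
    1 / (p + 1) * (1 * A), (p - 1) / (8 * (p + 1)) * (2 * B)}"
  have "\<bar>C12 p \<alpha>\<bar> \<le> K" "\<bar>C21 p \<alpha>\<bar> \<le> K" "\<bar>cos_remainder p \<alpha>\<bar> \<le> K" for \<alpha>
    unfolding K_def
    by (rule order_trans[OF C12 Max_ge] order_trans[OF C21 Max_ge] order_trans[OF D Max_ge]; simp)+
  then show ?thesis by blast
qed

section \<open>Decay of the oscillatory integral\<close>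

text \<open>
A quantitative Riemann-Lebesgue lemma. The interval is cut at \<open>b = 1 - 1 / \<alpha>\<close>. Left of \<open>b\<close> the
second mean value theorem uses that \<open>G\<close> is monotone and that the cosine has integrals of size
\<open>1 / \<alpha>\<close>; right of \<open>b\<close> the majorant itself has a small integral. The choice of \<open>b\<close> makes
the two contributions equal.
\<close>

lemma oscillatory_integral_bound:
  fixes G :: "real \<Rightarrow> real"
  assumes cont: "continuous_on {0..<1} G"
    and mono: "\<And>x y. 0 \<le> x \<Longrightarrow> x \<le> y \<Longrightarrow> y < 1 \<Longrightarrow> G x \<le> G y"
    and G: "\<And>s. 0 \<le> s \<Longrightarrow> s < 1 \<Longrightarrow> 0 \<le> G s" "\<And>s. 0 \<le> s \<Longrightarrow> s < 1 \<Longrightarrow> G s \<le> c / sqrt (1 - s)"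
    and \<alpha>: "\<alpha> > 1"
  shows "\<bar>integral {0..1} (\<lambda>s. G s * cos (2 * \<alpha> * s))\<bar> \<le> 4 * c / sqrt \<alpha>"
proof -
  let ?f = "\<lambda>s. G s * cos (2 * \<alpha> * s)"
  have bound: "\<bar>?f s\<bar> \<le> c / sqrt (1 - s)" if "0 \<le> s" "s < 1" for s
  proof -
    have "G s * \<bar>cos (2 * \<alpha> * s)\<bar> \<le> c / sqrt (1 - s) * 1"
      using G[OF that] by (intro mult_mono) auto
    then show ?thesis using G(1)[OF that] by (simp add: abs_mult)
  qed
  have int: "?f integrable_on {0..1}"
    unfolding integrable_on_open_interval_real[symmetric, of _ 0 1]
  proof (rule measurable_bounded_by_integrable_imp_integrable)
    show "?f \<in> borel_measurable (lebesgue_on {0<..<1})"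
      by (intro continuous_imp_measurable_on_sets_lebesgue continuous_intros
          continuous_on_subset[OF cont]) auto
    show "(\<lambda>s. c / sqrt (1 - s)) integrable_on {0<..<1}"
      unfolding integrable_on_open_interval_real using has_integral_inverse_sqrt[of 0 c] by auto
  qed (use bound in auto)
  define b where "b = 1 - 1 / \<alpha>"
  have b: "0 \<le> b" "b < 1" "1 - b = 1 / \<alpha>" using \<alpha> by (auto simp: b_def)
  have osc: "\<bar>integral {x..y} (\<lambda>s. cos (2 * \<alpha> * s))\<bar> \<le> 1 / \<alpha>" if "x \<le> y" for x y
  proof -
    have "((\<lambda>s. cos (2 * \<alpha> * s)) has_integral sin (2 * \<alpha> * y) / (2 * \<alpha>) - sin (2 * \<alpha> * x) / (2 * \<alpha>)) {x..y}"
      using \<alpha> by (intro fundamental_theorem_of_calculus[OF that])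
        (auto intro!: derivative_eq_intros simp: has_real_derivative_iff_has_vector_derivative[symmetric])
    then have "integral {x..y} (\<lambda>s. cos (2 * \<alpha> * s)) = (sin (2 * \<alpha> * y) - sin (2 * \<alpha> * x)) / (2 * \<alpha>)"
      by (simp add: integral_unique diff_divide_distrib)
    moreover have "\<bar>sin (2 * \<alpha> * y) - sin (2 * \<alpha> * x)\<bar> \<le> 2"
      using abs_sin_le_one[of "2 * \<alpha> * y"] abs_sin_le_one[of "2 * \<alpha> * x"] by linarith
    ultimately show ?thesis using \<alpha> by (simp add: field_simps)
  qed
  obtain z where z: "z \<in> {0..b}"
    "integral {0..b} ?f = G 0 * integral {0..z} (\<lambda>s. cos (2 * \<alpha> * s)) + G b * integral {z..b} (\<lambda>s. cos (2 * \<alpha> * s))"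
  proof (rule second_mean_value_theorem[of "\<lambda>s. cos (2 * \<alpha> * s)" 0 b G])
    show "(\<lambda>s. cos (2 * \<alpha> * s)) integrable_on {0..b}"
      by (intro integrable_continuous_real continuous_intros)
  qed (use b mono in auto)
  have "\<bar>G 0 * integral {0..z} (\<lambda>s. cos (2 * \<alpha> * s))\<bar> \<le> G b * (1 / \<alpha>)"
    unfolding abs_mult using z(1) b G(1)[of 0] G(1)[of b] mono[of 0 b] osc[of 0 z]
    by (intro mult_mono) auto
  moreover have "\<bar>G b * integral {z..b} (\<lambda>s. cos (2 * \<alpha> * s))\<bar> \<le> G b * (1 / \<alpha>)"
    unfolding abs_mult using z(1) b G(1)[of b] osc[of z b] by (intro mult_mono) auto
  ultimately have "\<bar>integral {0..b} ?f\<bar> \<le> G b * (1 / \<alpha>) + G b * (1 / \<alpha>)"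
    unfolding z(2) by linarith
  also have "\<dots> \<le> c / sqrt (1 - b) * (1 / \<alpha>) + c / sqrt (1 - b) * (1 / \<alpha>)"
    using \<alpha> b G(2)[of b] by (intro add_mono mult_right_mono) auto
  also have "\<dots> = 2 * c / sqrt \<alpha>"
    using \<alpha> unfolding b(3) by (simp add: real_sqrt_divide field_simps)
  finally have 1: "\<bar>integral {0..b} ?f\<bar> \<le> 2 * c / sqrt \<alpha>" .
  have "norm (integral {b..1} ?f) \<le> integral {b..1} (\<lambda>s. c / sqrt (1 - s))"
    unfolding integral_open_interval_real
  proof (rule integral_norm_bound_integral)
    show "?f integrable_on {b<..<1}"
      unfolding integrable_on_open_interval_real using b by (intro integrable_on_subinterval[OF int]) auto
    show "(\<lambda>s. c / sqrt (1 - s)) integrable_on {b<..<1}"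
      unfolding integrable_on_open_interval_real using has_integral_inverse_sqrt[of b c] b by auto
  qed (use bound b in auto)
  also have "\<dots> = 2 * c / sqrt \<alpha>"
    using integral_unique[OF has_integral_inverse_sqrt[of b c]] b by (simp add: real_sqrt_divide)
  finally have 2: "\<bar>integral {b..1} ?f\<bar> \<le> 2 * c / sqrt \<alpha>" by simp
  have "integral {0..1} ?f = integral {0..b} ?f + integral {b..1} ?f"
    using b by (intro Henstock_Kurzweil_Integration.integral_combine[symmetric] int) auto
  then show ?thesis using 1 2 by simp
qed

text \<open>
The inner integral in \<open>C3\<close> is increasing in \<open>s\<close> and grows like \<open>1 / sqrt (1 - s)\<close>, because its
integrand is at most \<open>2 * (1 - y) powr (-3/2)\<close>. So the oscillatory bound applies.
\<close>

lemma C3_tendsto_0: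
  assumes p: "p > 1"
  shows "(C3 p \<longlongrightarrow> 0) at_top"
proof -
  let ?h = "\<lambda>y. (1 - y\<^sup>2) / lead p y powr (5/2)"
  define G where "G s = integral {0..s} ?h" for s
  have h0: "0 \<le> ?h y" if "0 \<le> y" "y < 1" for y
    using that by (auto simp: power_le_one)
  have hc: "continuous_on {0..b} ?h" if "b < 1" for b
  proof -
    have "0 < lead p y" if "y \<in> {0..b}" for y using lead_pos[OF p] that \<open>b < 1\<close> by auto
    then show ?thesis using \<open>b < 1\<close>
      by (intro continuous_intros continuous_on_subset[OF continuous_lead[OF p]]) fastforce+
  qed
  have cont: "continuous_on {0..<1} G"
    unfolding continuous_on_eq_continuous_within
  proof
    fix s :: real assume s: "s \<in> {0..<1}"
    define b where "b = (s + 1) / 2"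
    have b: "s < b" "b < 1" using s by (auto simp: b_def)
    have "continuous_on {0..b} G"
      unfolding G_def using hc[OF b(2)] by (intro indefinite_integral_continuous_1 integrable_continuous_real)
    then have "continuous (at s within {0..b}) G"
      using s b by (auto simp: continuous_on_eq_continuous_within)
    moreover have "at s within {0..b} = at s within {0..<1}"
      by (rule at_within_nhd[of _ "{..<b}"]) (use b in auto)
    ultimately show "continuous (at s within {0..<1}) G" by (simp add: continuous_within)
  qed
  have mono: "G x \<le> G y" if "0 \<le> x" "x \<le> y" "y < 1" for x y
    unfolding G_def using that h0 hc[of x] hc[of y]
    by (intro integral_subset_le integrable_continuous_real) auto
  have bound: "G s \<le> 4 / sqrt (1 - s)" if s: "0 \<le> s" "s < 1" for s
  proof -
    have F: "((\<lambda>y. 2 / ((1 - y) * sqrt (1 - y))) has_integral 4 / sqrt (1 - s) - 4 / sqrt (1 - 0)) {0..s}"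
      using s by (intro fundamental_theorem_of_calculus)
        (auto intro!: derivative_eq_intros
          simp: has_real_derivative_iff_has_vector_derivative[symmetric] field_simps)
    have "G s \<le> integral {0..s} (\<lambda>y. 2 / ((1 - y) * sqrt (1 - y)))"
      unfolding G_def
    proof (rule integral_le)
      show "?h integrable_on {0..s}" using hc[OF s(2)] by (rule integrable_continuous_real)
      show "(\<lambda>y. 2 / ((1 - y) * sqrt (1 - y))) integrable_on {0..s}" using F by blast
      fix y assume "y \<in> {0..s}"
      then have y: "0 \<le> y" "y < 1" using s by auto
      have "(1 - y) powr (5/2) \<le> lead p y powr (5/2)"
        using lead_ge[OF p y(1)] y by (intro powr_mono2) auto
      moreover have "(1 + y) * (1 - y) \<le> 2 * (1 - y)" using y by (intro mult_right_mono) auto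
      then have "1 - y\<^sup>2 \<le> 2 * (1 - y)" by (simp add: algebra_simps power2_eq_square)
      ultimately have "?h y \<le> 2 * (1 - y) / (1 - y) powr (5/2)"
        using y by (intro frac_le) auto
      also have "\<dots> = 2 / ((1 - y) * sqrt (1 - y))"
      proof -
        define d where "d = 1 - y"
        then have "d > 0" using y by simp
        then show ?thesis unfolding d_def[symmetric] by (simp add: powr_5_2 power2_eq_square)
      qed
      finally show "?h y \<le> 2 / ((1 - y) * sqrt (1 - y))" .
    qed
    also have "\<dots> = 4 / sqrt (1 - s) - 4" using integral_unique[OF F] by simp
    finally show ?thesis by simp
  qed
  have nonneg: "0 \<le> G s" if "0 \<le> s" "s < 1" for s
    using mono[of 0 s] that by (simp add: G_def)
  show ?thesis
  proof (rule Lim_null_comparison)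
    show "\<forall>\<^sub>F \<alpha> in at_top. norm (C3 p \<alpha>) \<le> 3 / 32 * (p + 1)\<^sup>2 * (4 * 4 / sqrt \<alpha>)"
      using eventually_gt_at_top[of 1]
    proof eventually_elim
      case (elim \<alpha>)
      have "C3 p \<alpha> = - (3 / 32 * (p + 1)\<^sup>2) * integral {0..1} (\<lambda>s. G s * cos (2 * \<alpha> * s))"
        by (simp add: C3_def G_def lead_def)
      then show ?case
        using oscillatory_integral_bound[OF cont mono nonneg bound elim]
        by (simp only: real_norm_def abs_mult abs_minus) (intro mult_mono, auto)
    qed
    show "((\<lambda>\<alpha>. 3 / 32 * (p + 1)\<^sup>2 * (4 * 4 / sqrt \<alpha>)) \<longlongrightarrow> 0) at_top"
      by (intro tendsto_mult_right_zero tendsto_divide_0[OF tendsto_const]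
          filterlim_at_top_imp_at_infinity sqrt_at_top)
  qed
qed

section \<open>The asymptotic expansion\<close>

text \<open>
The error collects three contributions of order \<open>\<alpha> powr (2 * (1 - p))\<close> with vanishing
coefficient: the deviation of the second-order coefficient from its limit \<open>C2\<close>, the decaying
\<open>C3\<close>, and \<open>cos_remainder\<close>, which enters with \<open>\<alpha> powr (-1 - p)\<close>. That the last one is of smaller
order is the condition \<open>p < 3\<close>.
\<close>

lemma time_map_asymptotics:
  assumes p: "p > 1" "p < 3"
  obtains \<rho> where "(\<rho> \<longlongrightarrow> 0) at_top"
    and "\<And>\<alpha>. \<alpha> > 0 \<Longrightarrow> time_map p \<alpha> =
      C0 p + (C1 p + 1/2 * C11 p \<alpha>) * \<alpha> powr (1 - p)
      + (C12 p \<alpha> / 2 + C21 p \<alpha> / 2) * \<alpha> powr (- p)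
      + (C2 p + C3 p \<alpha>) * \<alpha> powr (2 * (1 - p)) + \<rho> \<alpha> * \<alpha> powr (2 * (1 - p))"
proof -
  obtain K where K: "\<And>\<alpha>. \<bar>cos_remainder p \<alpha>\<bar> \<le> K"
    using coefficients_bounded[OF p(1)] by blast
  define \<rho> where "\<rho> \<alpha> = ((p + 1)\<^sup>2 * second_order p \<alpha> - C2 p) - C3 p \<alpha>
    + cos_remainder p \<alpha> * \<alpha> powr (p - 3)" for \<alpha>
  have "((\<lambda>\<alpha>. cos_remainder p \<alpha> * \<alpha> powr (p - 3)) \<longlongrightarrow> 0) at_top"
  proof (rule Lim_null_comparison)
    show "\<forall>\<^sub>F \<alpha> in at_top. norm (cos_remainder p \<alpha> * \<alpha> powr (p - 3)) \<le> K * \<alpha> powr (p - 3)"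
      by (intro always_eventually allI) (simp add: abs_mult mult_right_mono[OF K])
    show "((\<lambda>\<alpha>. K * \<alpha> powr (p - 3)) \<longlongrightarrow> 0) at_top"
      using p by (intro tendsto_mult_right_zero tendsto_neg_powr filterlim_ident) auto
  qed
  from tendsto_add[OF tendsto_diff[OF tendsto_diff[OF second_order_tendsto[OF p(1)] tendsto_const[of "C2 p"]]
    C3_tendsto_0[OF p(1)]] this]
  have lim: "(\<rho> \<longlongrightarrow> 0) at_top"
    by (simp add: \<rho>_def[abs_def])
  have tm: "time_map p \<alpha> =
      C0 p + (C1 p + 1/2 * C11 p \<alpha>) * \<alpha> powr (1 - p)
      + (C12 p \<alpha> / 2 + C21 p \<alpha> / 2) * \<alpha> powr (- p)
      + (C2 p + C3 p \<alpha>) * \<alpha> powr (2 * (1 - p)) + \<rho> \<alpha> * \<alpha> powr (2 * (1 - p))" if \<alpha>: "\<alpha> > 0" for \<alpha>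
  proof -
    define u v w where "u = \<alpha> powr (1 - p)" and "v = \<alpha> powr (- p)" and "w = \<alpha> powr (2 * (1 - p))"
    have u1: "u = \<alpha> * v"
      using \<alpha> by (simp add: u_def v_def powr_mult_base)
    have u2: "u = \<alpha>\<^sup>2 * (\<alpha> powr (p - 3) * w)"
    proof -
      have "u = \<alpha> powr (2 + (p - 3 + 2 * (1 - p)))"
        unfolding u_def by (rule arg_cong) simp
      also have "\<dots> = \<alpha> powr 2 * (\<alpha> powr (p - 3) * w)" by (simp only: powr_add w_def)
      finally show ?thesis using \<alpha> by simp
    qed
    have e1: "u / \<alpha> = v" unfolding u1 using \<alpha> by simp
    have e2: "u / \<alpha>\<^sup>2 = \<alpha> powr (p - 3) * w" unfolding u2 using \<alpha> by simp
    have "time_map p \<alpha> = C0 p + (C1 p + C11 p \<alpha> / 2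
      + (C12 p \<alpha> + C21 p \<alpha>) / (2 * \<alpha>) + cos_remainder p \<alpha> / \<alpha>\<^sup>2) * u
      + (p + 1)\<^sup>2 * second_order p \<alpha> * w"
      unfolding time_map_expansion[OF p(1) \<alpha>] first_order_expansion[OF p(1) \<alpha>] u_def w_def
      by (simp only: mult_minus_left diff_minus_eq_add)
    also have "(C1 p + C11 p \<alpha> / 2
      + (C12 p \<alpha> + C21 p \<alpha>) / (2 * \<alpha>) + cos_remainder p \<alpha> / \<alpha>\<^sup>2) * u
      = (C1 p + 1/2 * C11 p \<alpha>) * u + (C12 p \<alpha> / 2 + C21 p \<alpha> / 2) * (u / \<alpha>)
      + cos_remainder p \<alpha> * (u / \<alpha>\<^sup>2)"
      by (simp add: distrib_right add_divide_distrib)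
    finally show ?thesis
      unfolding e1 e2 u_def[symmetric] v_def[symmetric] w_def[symmetric] \<rho>_def
      by (simp add: algebra_simps)
  qed
  show thesis by (rule that[OF lim tm])
qed

theorem theorem1p4:
  fixes p :: real and \<mu> :: "real \<Rightarrow> real"
  assumes "p > 1"
    and "\<And>\<alpha>. \<alpha> > 0 \<Longrightarrow> bifurcation_parameter p \<alpha> (\<mu> \<alpha>)"
  shows
    "(1 < p \<and> p < 2 \<longrightarrow>
        (\<exists>r \<in> o[at_top](\<lambda>\<alpha>::real. \<alpha> powr (2 * (1 - p))).
           \<forall>\<^sub>F \<alpha> in at_top.
             \<mu> \<alpha> = 2 * (p + 1) * \<alpha> powr (1 - p) *
               (C0 p + (C1 p + 1/2 * C11 p \<alpha>) * \<alpha> powr (1 - p)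
                 + (C2 p + C3 p \<alpha>) * \<alpha> powr (2 * (1 - p)) + r \<alpha>)\<^sup>2)) \<and>
     (p = 2 \<longrightarrow>
        (\<exists>r \<in> o[at_top](\<lambda>\<alpha>::real. \<alpha> powr (2 * (1 - p))).
           \<forall>\<^sub>F \<alpha> in at_top.
             \<mu> \<alpha> = 6 * \<alpha> powr (-1) *
               (C0 p + (C1 p + 1/2 * C11 p \<alpha>) * \<alpha> powr (-1)
                 + (1/2 * C12 p \<alpha> + 1/2 * C21 p \<alpha> + C2 p + C3 p \<alpha>) * \<alpha> powr (-2) + r \<alpha>)\<^sup>2))"
proof (intro conjI impI)
  have \<mu>: "\<mu> \<alpha> = 2 * (p + 1) * \<alpha> powr (1 - p) * (time_map p \<alpha>)\<^sup>2" if "\<alpha> > 0" for \<alpha>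
    using time_map_formula[OF assms(1) that assms(2)[OF that]] .
  have smallo: "(\<lambda>\<alpha>. \<rho> \<alpha> * \<alpha> powr (2 * (1 - p))) \<in> o[at_top](\<lambda>\<alpha>. \<alpha> powr (2 * (1 - p)))"
    if "(\<rho> \<longlongrightarrow> 0) at_top" for \<rho> :: "real \<Rightarrow> real"
  proof (rule smalloI_tendsto)
    show "\<forall>\<^sub>F \<alpha>::real in at_top. \<alpha> powr (2 * (1 - p)) \<noteq> 0"
      using eventually_gt_at_top[of 0] by eventually_elim simp
    show "((\<lambda>\<alpha>. \<rho> \<alpha> * \<alpha> powr (2 * (1 - p)) / \<alpha> powr (2 * (1 - p))) \<longlongrightarrow> 0) at_top"
      by (rule Lim_transform_eventually[OF that], use eventually_gt_at_top[of 0] in eventually_elim) simp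
  qed
  {
    assume p2: "1 < p \<and> p < 2"
    obtain \<rho> where \<rho>: "(\<rho> \<longlongrightarrow> 0) at_top"
      and T: "\<And>\<alpha>. \<alpha> > 0 \<Longrightarrow> time_map p \<alpha> =
        C0 p + (C1 p + 1/2 * C11 p \<alpha>) * \<alpha> powr (1 - p)
        + (C12 p \<alpha> / 2 + C21 p \<alpha> / 2) * \<alpha> powr (- p)
        + (C2 p + C3 p \<alpha>) * \<alpha> powr (2 * (1 - p)) + \<rho> \<alpha> * \<alpha> powr (2 * (1 - p))"
      using time_map_asymptotics[of p] p2 by auto
    \<comment> \<open>For \<open>p < 2\<close> the bounded coefficients \<open>C12\<close> and \<open>C21\<close>, which come with \<open>\<alpha> powr (- p)\<close>,
      are of smaller order than \<open>\<alpha> powr (2 * (1 - p))\<close> and join the error; for \<open>p = 2\<close> the two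
      orders coincide.\<close>
    obtain K where K: "\<And>\<alpha>. \<bar>C12 p \<alpha>\<bar> \<le> K" "\<And>\<alpha>. \<bar>C21 p \<alpha>\<bar> \<le> K"
      using coefficients_bounded[OF assms(1)] by blast
    have "((\<lambda>\<alpha>. (C12 p \<alpha> / 2 + C21 p \<alpha> / 2) * \<alpha> powr (p - 2)) \<longlongrightarrow> 0) at_top"
    proof (rule Lim_null_comparison)
      have b: "\<bar>C12 p \<alpha> / 2 + C21 p \<alpha> / 2\<bar> \<le> K" for \<alpha>
        using K[of \<alpha>] by linarith
      show "\<forall>\<^sub>F \<alpha> in at_top. norm ((C12 p \<alpha> / 2 + C21 p \<alpha> / 2) * \<alpha> powr (p - 2)) \<le> K * \<alpha> powr (p - 2)"
        unfolding real_norm_def abs_mult by (intro always_eventually allI) (simp add: mult_right_mono[OF b])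
      show "((\<lambda>\<alpha>. K * \<alpha> powr (p - 2)) \<longlongrightarrow> 0) at_top"
        using p2 by (intro tendsto_mult_right_zero tendsto_neg_powr filterlim_ident) auto
    qed
    from tendsto_add[OF this \<rho>]
    have "((\<lambda>\<alpha>. (C12 p \<alpha> / 2 + C21 p \<alpha> / 2) * \<alpha> powr (p - 2) + \<rho> \<alpha>) \<longlongrightarrow> 0) at_top"
      by simp
    from smallo[OF this]
    show "\<exists>r \<in> o[at_top](\<lambda>\<alpha>::real. \<alpha> powr (2 * (1 - p))).
           \<forall>\<^sub>F \<alpha> in at_top.
             \<mu> \<alpha> = 2 * (p + 1) * \<alpha> powr (1 - p) *
               (C0 p + (C1 p + 1/2 * C11 p \<alpha>) * \<alpha> powr (1 - p)
                 + (C2 p + C3 p \<alpha>) * \<alpha> powr (2 * (1 - p)) + r \<alpha>)\<^sup>2"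
    proof (rule bexI[rotated], use eventually_gt_at_top[of 0] in eventually_elim)
      case (elim \<alpha>)
      have "\<alpha> powr (p - 2) * \<alpha> powr (2 * (1 - p)) = \<alpha> powr (- p)"
        by (simp add: powr_add[symmetric])
      then have "time_map p \<alpha> = C0 p + (C1 p + 1/2 * C11 p \<alpha>) * \<alpha> powr (1 - p)
          + (C2 p + C3 p \<alpha>) * \<alpha> powr (2 * (1 - p))
          + ((C12 p \<alpha> / 2 + C21 p \<alpha> / 2) * \<alpha> powr (p - 2) + \<rho> \<alpha>) * \<alpha> powr (2 * (1 - p))"
        unfolding T[OF elim] distrib_right[of _ "\<rho> \<alpha>"] mult.assoc by simp
      then show ?case unfolding \<mu>[OF elim] by simp
    qed
  }
  {
    assume p2: "p = 2"
    obtain \<rho> where \<rho>: "(\<rho> \<longlongrightarrow> 0) at_top"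
      and T: "\<And>\<alpha>. \<alpha> > 0 \<Longrightarrow> time_map p \<alpha> =
        C0 p + (C1 p + 1/2 * C11 p \<alpha>) * \<alpha> powr (1 - p)
        + (C12 p \<alpha> / 2 + C21 p \<alpha> / 2) * \<alpha> powr (- p)
        + (C2 p + C3 p \<alpha>) * \<alpha> powr (2 * (1 - p)) + \<rho> \<alpha> * \<alpha> powr (2 * (1 - p))"
      using time_map_asymptotics[of p] p2 by auto
    show "\<exists>r \<in> o[at_top](\<lambda>\<alpha>::real. \<alpha> powr (2 * (1 - p))).
           \<forall>\<^sub>F \<alpha> in at_top.
             \<mu> \<alpha> = 6 * \<alpha> powr (-1) *
               (C0 p + (C1 p + 1/2 * C11 p \<alpha>) * \<alpha> powr (-1)
                 + (1/2 * C12 p \<alpha> + 1/2 * C21 p \<alpha> + C2 p + C3 p \<alpha>) * \<alpha> powr (-2) + r \<alpha>)\<^sup>2"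
    proof (rule bexI[OF _ smallo[OF \<rho>]], use eventually_gt_at_top[of 0] in eventually_elim)
      case (elim \<alpha>)
      have "time_map p \<alpha> = C0 p + (C1 p + 1/2 * C11 p \<alpha>) * \<alpha> powr (-1)
          + (1/2 * C12 p \<alpha> + 1/2 * C21 p \<alpha> + C2 p + C3 p \<alpha>) * \<alpha> powr (-2)
          + \<rho> \<alpha> * \<alpha> powr (2 * (1 - p))"
        unfolding T[OF elim] using p2 by (simp add: algebra_simps)
      moreover have "\<mu> \<alpha> = 6 * \<alpha> powr (-1) * (time_map p \<alpha>)\<^sup>2"
        unfolding \<mu>[OF elim] using p2 by simp
      ultimately show ?case by simp
    qed
  }
qed

end
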